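(* Let $G$ be a finitely generated abelian group, $\mathcal{L}=(g_e)_{e\in E}$ a finite list in $G$, and $H\cong\bigoplus_{i=1}^k\mathbb{Z}_{q_i}$ a finite abelian group with $q=|H|$. Then $$Z_\mathcal{L}(G,H,\mathbf{v})=q^{\rk(G)}\sum_{A\subseteq E}q^{-\rk(A)}\prod_{i=1}^k\frac{m(A)}{|q_iG_A|}\prod_{e\in A}v_e.$$
   Context: $\mathbb{Z}_q=\mathbb{Z}/q\mathbb{Z}$. $Z_\mathcal{L}(G,H,\mathbf{v}):=\sum_{\phi\in\Hom(G,H)}\prod_{e\in E}(1+v_e\delta(\phi(g_e),0))$, where $\delta$ is the Kronecker delta and $\mathbf{v}=(v_e)_{e\in E}$ are variables. $\rk(G)$ is the rank of $G$. For $A\subseteq E$, $\rk(A)$ is the rank of the subgroup $\langle\mathcal{L}_A\rangle$ generated by $(g_e)_{e\in A}$, $G_A$ is the torsion subgroup of $G/\langle\mathcal{L}_A\rangle$, $m(A)=|G_A|$, and for an integer $n$, $nG_A=\{nh:h\in G_A\}$. *)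

theory Defs
  imports "HOL-Algebra.Algebra"
begin

text \<open>
  Groups are written multiplicatively, as in HOL-Algebra: the integer multiple \<open>n x\<close> of the
  additive notation is \<open>x [^] n\<close>, and \<open>0\<close> is \<open>\<one>\<close>.
\<close>

definition finitely_generated_group :: "('a, 'm) monoid_scheme \<Rightarrow> bool" where
  "finitely_generated_group G \<longleftrightarrow>
     (\<exists>S. finite S \<and> S \<subseteq> carrier G \<and> generate G S = carrier G)"

definition int_independent :: "('a, 'm) monoid_scheme \<Rightarrow> 'a set \<Rightarrow> bool" where
  "int_independent G S \<longleftrightarrow>
     S \<subseteq> carrier G \<and> finite S \<and>
     (\<forall>c :: 'a \<Rightarrow> int. (\<Otimes>\<^bsub>G\<^esub>x\<in>S. x [^]\<^bsub>G\<^esub> c x) = \<one>\<^bsub>G\<^esub> \<longrightarrow> (\<forall>x\<in>S. c x = 0))"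

text \<open>
  The maximal number of elements linearly independent over the integers. The maximum exists when
  \<open>G\<close> is abelian and finitely generated (a bound is the size of a generating set); the definition
  carries no information if the set of cardinalities is unbounded.
\<close>
definition rank_group :: "('a, 'm) monoid_scheme \<Rightarrow> nat" where
  "rank_group G = Max {card S | S. int_independent G S}"

definition torsion_subgroup :: "('a, 'm) monoid_scheme \<Rightarrow> 'a set" where
  "torsion_subgroup G = {x \<in> carrier G. \<exists>n::nat. n > 0 \<and> x [^]\<^bsub>G\<^esub> n = \<one>\<^bsub>G\<^esub>}"

text \<open>A list \<open>(g\<^sub>e)\<close> indexed by \<open>e \<in> E\<close> is a function \<open>g\<close> on the index type, used on \<open>E\<close> only.\<close>

definition rank_list :: "('a, 'm) monoid_scheme \<Rightarrow> ('e \<Rightarrow> 'a) \<Rightarrow> 'e set \<Rightarrow> nat" where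
  "rank_list G g A = rank_group (subgroup_generated G (g ` A))"

definition tors_quot :: "('a, 'm) monoid_scheme \<Rightarrow> ('e \<Rightarrow> 'a) \<Rightarrow> 'e set \<Rightarrow> 'a set set" where
  "tors_quot G g A = torsion_subgroup (G Mod generate G (g ` A))"

definition mult_list :: "('a, 'm) monoid_scheme \<Rightarrow> ('e \<Rightarrow> 'a) \<Rightarrow> 'e set \<Rightarrow> nat" where
  "mult_list G g A = card (tors_quot G g A)"

definition multiples_tors_quot ::
  "int \<Rightarrow> ('a, 'm) monoid_scheme \<Rightarrow> ('e \<Rightarrow> 'a) \<Rightarrow> 'e set \<Rightarrow> 'a set set" where
  "multiples_tors_quot n G g A =
     (\<lambda>h. h [^]\<^bsub>G Mod generate G (g ` A)\<^esub> n) ` tors_quot G g A"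

text \<open>
  The set \<open>hom G H\<close> does not restrict the values of a map outside \<open>carrier G\<close>; intersecting it with
  \<open>extensional (carrier G)\<close> makes each homomorphism occur exactly once in the sum.
\<close>
definition Z_poly ::
  "('a, 'm) monoid_scheme \<Rightarrow> 'e set \<Rightarrow> ('e \<Rightarrow> 'a) \<Rightarrow> ('b, 'n) monoid_scheme \<Rightarrow>
   ('e \<Rightarrow> 'r::comm_ring_1) \<Rightarrow> 'r" where
  "Z_poly G E g H v =
     (\<Sum>\<phi> \<in> hom G H \<inter> extensional (carrier G).
        \<Prod>e\<in>E. 1 + v e * (if \<phi> (g e) = \<one>\<^bsub>H\<^esub> then 1 else 0))"

end

theory Submission
  imports Defs
begin

text \<open>
  Expanding the product over \<open>E\<close>, the coefficient of \<open>\<Prod>e\<in>A. v e\<close> is the number of homomorphisms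
  \<open>G \<rightarrow> H\<close> that kill \<open>g e\<close> for all \<open>e \<in> A\<close>, and this number is multiplicative in the cyclic
  factors of \<open>H\<close>. Let \<open>Q\<close> be the quotient of \<open>G\<close> by the subgroup generated by these \<open>g e\<close>.
  Homomorphisms \<open>Q \<rightarrow> \<int>/n\<close> are counted by \<open>[Q : nQ]\<close>: extending a homomorphism to one more
  generator of order \<open>d\<close> modulo the previous ones amounts to choosing a \<open>d\<close>-th part of a given
  element of \<open>\<int>/n\<close>, for which there are exactly \<open>d\<close> choices. If \<open>F\<close> is a free subgroup of
  finite index in \<open>Q\<close>, of rank \<open>r\<close>, then comparing the chains \<open>nF \<le> F \<le> Q\<close> and
  \<open>nF \<le> nQ \<le> Q\<close> yields \<open>[Q : nQ] = n ^ r * |Q[n]|\<close>, where \<open>Q[n]\<close> is the \<open>n\<close>-torsion, and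
  \<open>|Q[n]| = |T| / |nT|\<close> for the torsion subgroup \<open>T\<close>. The same index formula with \<open>n = 2\<close> shows
  that all independent sets generating a subgroup of finite index have the same size, which
  identifies the rank and makes it additive.
\<close>

section \<open>Indices of subgroups\<close>

text \<open>
  The index of \<open>A\<close> in \<open>C\<close> is expressed as the cardinality of the set \<open>(#>) A ` C\<close> of cosets in
  the ambient group, which avoids viewing \<open>C\<close> as a group of its own.
\<close>

lemma (in group) rcos_eq_iff:
  assumes "subgroup B G" "x \<in> carrier G" "y \<in> carrier G"
  shows "B #> x = B #> y \<longleftrightarrow> x \<otimes> inv y \<in> B"
proof
  assume "B #> x = B #> y"
  then have "x \<in> B #> y" using rcos_self assms by blast
  then show "x \<otimes> inv y \<in> B"
    using subgroup.rcos_module_imp[OF assms(1) is_group] assms by blast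
next
  assume "x \<otimes> inv y \<in> B"
  then have "x \<in> B #> y"
    using subgroup.rcos_module_rev[OF assms(1) is_group] assms by blast
  then show "B #> x = B #> y"
    using repr_independence assms by metis
qed

context comm_group
begin

lemma mult_inv_cancel_common:
  assumes "x \<in> carrier G" "y \<in> carrier G" "z \<in> carrier G"
  shows "(x \<otimes> z) \<otimes> inv (y \<otimes> z) = x \<otimes> inv y"
proof -
  have "(x \<otimes> z) \<otimes> inv (y \<otimes> z) = x \<otimes> (z \<otimes> inv z) \<otimes> inv y"
    using assms unfolding inv_mult_group[OF assms(2,3)] by (simp only: m_assoc m_closed inv_closed)
  then show ?thesis using assms by simp
qed

text \<open>The tower law. With representatives \<open>r Y\<close> chosen for the cosets of
  \<open>B\<close> in \<open>C\<close>, the pair of \<open>Y\<close> and \<open>A #> b\<close>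
  corresponds to the coset \<open>A #> (b \<otimes> r Y)\<close>; conversely \<open>c\<close> is
  split as \<open>c \<otimes> inv (r (B #> c))\<close> in \<open>B\<close> times the representative
  of \<open>B #> c\<close>.\<close>

lemma cosets_tower_eqpoll:
  assumes A: "subgroup A G" and B: "subgroup B G" and C: "subgroup C G"
    and AB: "A \<subseteq> B" and BC: "B \<subseteq> C"
  shows "(#>) A ` C \<approx> ((#>) B ` C) \<times> ((#>) A ` B)"
proof -
  interpret A: subgroup A G by fact
  interpret B: subgroup B G by fact
  interpret C: subgroup C G by fact
  have "\<forall>Y\<in>(#>) B ` C. \<exists>c. c \<in> C \<and> Y = B #> c" by blast
  from bchoice[OF this] obtain r where r: "\<And>Y. Y \<in> (#>) B ` C \<Longrightarrow> r Y \<in> C \<and> Y = B #> r Y"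
    by blast
  define h where "h = (\<lambda>(Y, Z). Z #> r Y)"
  have h: "h (Y, A #> b) = A #> (b \<otimes> r Y)" if "Y \<in> (#>) B ` C" "b \<in> B" for Y b
    using that r[of Y] by (simp add: h_def coset_mult_assoc A.subset)
  have bc: "B #> (b \<otimes> c) = B #> c" if "b \<in> B" "c \<in> carrier G" for b c
    using that B.subgroup_axioms by (simp add: rcos_eq_iff m_assoc)
  have "inj_on h (((#>) B ` C) \<times> ((#>) A ` B))"
  proof (rule inj_onI, clarify)
    fix c c' b b'
    assume 1: "c \<in> C" "b \<in> B" "c' \<in> C" "b' \<in> B"
      and eq: "h (B #> c, A #> b) = h (B #> c', A #> b')"
    let ?r = "r (B #> c)" and ?r' = "r (B #> c')"
    have r1: "?r \<in> C" "B #> c = B #> ?r" "?r' \<in> C" "B #> c' = B #> ?r'"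
      using r 1 by blast+
    have eq': "A #> (b \<otimes> ?r) = A #> (b' \<otimes> ?r')" using eq h 1 by simp
    then have in_A: "(b \<otimes> ?r) \<otimes> inv (b' \<otimes> ?r') \<in> A"
      using 1 r1 A.subgroup_axioms by (simp add: rcos_eq_iff)
    \<comment> \<open>Passing to cosets of the larger \<open>B\<close> absorbs \<open>b\<close> and
      \<open>b'\<close>, so the first components agree. Both sides then carry the same
      representative, which cancels and leaves \<open>b \<otimes> inv b'\<close> in
      \<open>A\<close>.\<close>
    have "B #> (b \<otimes> ?r) = B #> (b' \<otimes> ?r')"
      using 1 r1 in_A AB B.subgroup_axioms by (subst rcos_eq_iff) auto
    then have Beq: "B #> c = B #> c'" using bc 1 r1 by simp
    have "(b \<otimes> ?r) \<otimes> inv (b' \<otimes> ?r) = b \<otimes> inv b'"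
      using 1 r1 by (intro mult_inv_cancel_common) auto
    then have "b \<otimes> inv b' \<in> A" using in_A Beq by argo
    then have "A #> b = A #> b'" using 1 A.subgroup_axioms by (simp add: rcos_eq_iff)
    then show "B #> c = B #> c' \<and> A #> b = A #> b'" using Beq by simp
  qed
  moreover have "h ` (((#>) B ` C) \<times> ((#>) A ` B)) = (#>) A ` C"
  proof (intro equalityI subsetI; clarify)
    fix c b assume 1: "c \<in> C" "b \<in> B"
    then show "h (B #> c, A #> b) \<in> (#>) A ` C"
      using h[of "B #> c" b] r[of "B #> c"] BC by auto
  next
    fix c assume c: "c \<in> C"
    define b where "b = c \<otimes> inv (r (B #> c))"
    have r1: "r (B #> c) \<in> C" "B #> c = B #> r (B #> c)" using r c by blast+
    then have b: "b \<in> B" using c B.subgroup_axioms by (simp add: b_def flip: rcos_eq_iff)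
    have "h (B #> c, A #> b) = A #> c"
      using c r1 b by (subst h) (auto simp: b_def m_assoc)
    then show "A #> c \<in> h ` (((#>) B ` C) \<times> ((#>) A ` B))"
      using c b by (metis (no_types) SigmaI imageI)
  qed
  ultimately have "bij_betw h (((#>) B ` C) \<times> ((#>) A ` B)) ((#>) A ` C)"
    by (simp add: bij_betw_def)
  then show ?thesis using eqpoll_def eqpoll_sym by blast
qed

text \<open>Let \<open>T\<close> be the kernel of \<open>f\<close> on \<open>C\<close>. The map from
  \<open>C\<close> to the cosets of the image of \<open>A\<close> has kernel \<open>A T\<close>, and
  since \<open>A\<close> meets \<open>T\<close> trivially, the cosets of \<open>A\<close> in
  \<open>A T\<close> are represented once each by \<open>T\<close>. Equipollence, unlike an equation
  of cardinalities, also lets finite index of \<open>A\<close> imply finiteness of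
  \<open>T\<close>.\<close>

lemma cosets_hom_image_eqpoll:
  assumes f: "group_hom G K f" and A: "subgroup A G" and C: "subgroup C G" and AC: "A \<subseteq> C"
    and triv: "\<And>a. a \<in> A \<Longrightarrow> f a = \<one>\<^bsub>K\<^esub> \<Longrightarrow> a = \<one>"
  shows "(#>) A ` C \<approx> ((#>\<^bsub>K\<^esub>) (f ` A) ` f ` C) \<times> {t \<in> C. f t = \<one>\<^bsub>K\<^esub>}"
proof -
  interpret f: group_hom G K f by fact
  interpret A: subgroup A G by fact
  interpret C: subgroup C G by fact
  interpret fA: subgroup "f ` A" K using f.subgroup_img_is_subgroup[OF A] .
  define r where "r Y = (SOME c. c \<in> C \<and> Y = f ` A #>\<^bsub>K\<^esub> f c)" for Y
  have rY: "r (f ` A #>\<^bsub>K\<^esub> f c) \<in> C \<and> f ` A #>\<^bsub>K\<^esub> f c = f ` A #>\<^bsub>K\<^esub> f (r (f ` A #>\<^bsub>K\<^esub> f c))"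
    if "c \<in> C" for c
    unfolding r_def by (rule someI[of _ c]) (use that in simp)
  note r = rY[THEN conjunct1] rY[THEN conjunct2]
  define h where "h = (\<lambda>(Y, t). A #> (r Y \<otimes> t))"
  have "inj_on h (((#>\<^bsub>K\<^esub>) (f ` A) ` f ` C) \<times> {t \<in> C. f t = \<one>\<^bsub>K\<^esub>})"
  proof (rule inj_onI, clarify)
    fix c c' t t'
    let ?Y = "f ` A #>\<^bsub>K\<^esub> f c" and ?Y' = "f ` A #>\<^bsub>K\<^esub> f c'"
    assume 1: "c \<in> C" "c' \<in> C" "t \<in> C" "t' \<in> C" "f t = \<one>\<^bsub>K\<^esub>" "f t' = \<one>\<^bsub>K\<^esub>"
      and eq: "h (?Y, t) = h (?Y', t')"
    have r1: "r ?Y \<in> C" "?Y = f ` A #>\<^bsub>K\<^esub> f (r ?Y)" "r ?Y' \<in> C" "?Y' = f ` A #>\<^bsub>K\<^esub> f (r ?Y')"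
      by (fact r(1)[OF 1(1)] r(2)[OF 1(1)] r(1)[OF 1(2)] r(2)[OF 1(2)])+
    have "A #> (r ?Y \<otimes> t) = A #> (r ?Y' \<otimes> t')" using eq by (simp add: h_def)
    then have in_A: "(r ?Y \<otimes> t) \<otimes> inv (r ?Y' \<otimes> t') \<in> A"
      using 1 r1 A.subgroup_axioms by (simp add: rcos_eq_iff)
    then have "f ((r ?Y \<otimes> t) \<otimes> inv (r ?Y' \<otimes> t')) \<in> f ` A" by blast
    then have "f (r ?Y) \<otimes>\<^bsub>K\<^esub> inv\<^bsub>K\<^esub> f (r ?Y') \<in> f ` A"
      using 1 r1 by simp
    then have Yeq: "?Y = ?Y'"
      using r1 fA.subgroup_axioms by (metis C.mem_carrier f.hom_closed f.H.rcos_eq_iff)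
    have "(t \<otimes> r ?Y) \<otimes> inv (t' \<otimes> r ?Y) = t \<otimes> inv t'"
      using 1 r1 by (intro mult_inv_cancel_common) auto
    moreover have "r ?Y \<otimes> t = t \<otimes> r ?Y" "r ?Y \<otimes> t' = t' \<otimes> r ?Y"
      using 1 r1 by (auto intro: m_comm)
    ultimately have "t \<otimes> inv t' \<in> A" using in_A Yeq by metis
    moreover have "f (t \<otimes> inv t') = \<one>\<^bsub>K\<^esub>" using 1 by simp
    ultimately have "t \<otimes> inv t' = \<one>" using triv by blast
    then have "t = t'" using 1 by (metis C.mem_carrier inv_closed inv_equality inv_inv)
    then show "?Y = ?Y' \<and> t = t'" using Yeq by simp
  qed
  moreover have "h ` (((#>\<^bsub>K\<^esub>) (f ` A) ` f ` C) \<times> {t \<in> C. f t = \<one>\<^bsub>K\<^esub>}) = (#>) A ` C"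
  proof (intro equalityI subsetI; clarify)
    fix c t assume 1: "c \<in> C" "t \<in> C" "f t = \<one>\<^bsub>K\<^esub>"
    then show "h (f ` A #>\<^bsub>K\<^esub> f c, t) \<in> (#>) A ` C"
      using r(1)[of c] by (auto simp: h_def)
  next
    fix c assume c: "c \<in> C"
    let ?Y = "f ` A #>\<^bsub>K\<^esub> f c"
    have r1: "r ?Y \<in> C" "?Y = f ` A #>\<^bsub>K\<^esub> f (r ?Y)" by (fact r(1)[OF c] r(2)[OF c])+
    have "f c \<otimes>\<^bsub>K\<^esub> inv\<^bsub>K\<^esub> f (r ?Y) \<in> f ` A"
      using r1 fA.subgroup_axioms c by (metis C.mem_carrier f.hom_closed f.H.rcos_eq_iff)
    then obtain a where a: "a \<in> A" "f c \<otimes>\<^bsub>K\<^esub> inv\<^bsub>K\<^esub> f (r ?Y) = f a" by blast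
    \<comment> \<open>The quotient of \<open>c\<close> by its representative has the same image as
      \<open>a\<close>; dividing by \<open>a\<close> moves it into the kernel without changing the
      coset of \<open>A\<close>.\<close>
    define t where "t = inv a \<otimes> (c \<otimes> inv (r ?Y))"
    have t: "t \<in> C" using a c r1 AC by (auto simp: t_def)
    have ft: "f t = \<one>\<^bsub>K\<^esub>" using a c r1 by (simp add: t_def)
    have ca: "c \<otimes> inv (r ?Y \<otimes> t) = a"
    proof -
      have "r ?Y \<otimes> t = t \<otimes> r ?Y" using r1 t by (intro m_comm) auto
      also have "\<dots> = inv a \<otimes> c" unfolding t_def using a c r1(1) by (simp add: m_assoc)
      finally have "r ?Y \<otimes> t = inv a \<otimes> c" .
      then have "a \<otimes> (r ?Y \<otimes> t) = c"
        using a c by (metis A.mem_carrier C.mem_carrier inv_closed m_assoc r_inv l_one)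
      then show ?thesis using a c t r1
        by (metis A.mem_carrier C.mem_carrier inv_solve_right' m_closed)
    qed
    have "h (?Y, t) = A #> c"
      using a c t r1(1) ca rcos_eq_iff[OF A, of c "r ?Y \<otimes> t"] by (simp add: h_def)
    then show "A #> c \<in> h ` (((#>\<^bsub>K\<^esub>) (f ` A) ` f ` C) \<times> {t \<in> C. f t = \<one>\<^bsub>K\<^esub>})"
      using c t ft by (metis (mono_tags, lifting) SigmaI imageI mem_Collect_eq)
  qed
  ultimately have "bij_betw h (((#>\<^bsub>K\<^esub>) (f ` A) ` f ` C) \<times> {t \<in> C. f t = \<one>\<^bsub>K\<^esub>}) ((#>) A ` C)"
    by (simp add: bij_betw_def)
  then show ?thesis using eqpoll_def eqpoll_sym by blast
qed

text \<open>The correspondence theorem: as \<open>A\<close> contains the kernel, it is the full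
  preimage of its image, so equality of cosets can be tested after applying \<open>f\<close>. It
  later pulls an index in a quotient back to \<open>G\<close>.\<close>

lemma card_cosets_hom_image_kernel:
  assumes f: "group_hom G K f" and A: "subgroup A G" and C: "subgroup C G" and AC: "A \<subseteq> C"
    and ker: "kernel G K f \<subseteq> A"
  shows "card ((#>) A ` C) = card ((#>\<^bsub>K\<^esub>) (f ` A) ` f ` C)"
proof -
  interpret f: group_hom G K f by fact
  interpret A: subgroup A G by fact
  interpret C: subgroup C G by fact
  interpret fA: subgroup "f ` A" K using f.subgroup_img_is_subgroup[OF A] .
  have iff: "f ` A #>\<^bsub>K\<^esub> f x = f ` A #>\<^bsub>K\<^esub> f y \<longleftrightarrow> A #> x = A #> y" if "x \<in> C" "y \<in> C" for x y
  proof -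
    have "z \<in> A" if z: "z \<in> carrier G" "f z \<in> f ` A" for z
    proof -
      obtain a where a: "a \<in> A" "f z = f a" using z by blast
      then have "inv a \<otimes> z \<in> kernel G K f" using z by (simp add: kernel_def)
      then have "a \<otimes> (inv a \<otimes> z) \<in> A" using ker a by blast
      then show ?thesis using a z by (simp add: m_assoc[symmetric])
    qed
    then have "f (x \<otimes> inv y) \<in> f ` A \<longleftrightarrow> x \<otimes> inv y \<in> A"
      using that by (meson C.m_closed C.m_inv_closed C.mem_carrier imageI)
    then show ?thesis using that A.subgroup_axioms fA.subgroup_axioms
      by (simp add: rcos_eq_iff f.H.rcos_eq_iff)
  qed
  show ?thesis
  proof (rule bij_betw_same_card)
    define r where "r Y = (SOME c. c \<in> C \<and> A #> c = Y)" for Y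
    have r: "r (A #> c) \<in> C \<and> A #> r (A #> c) = A #> c" if "c \<in> C" for c
      unfolding r_def by (rule someI[of _ c]) (use that in simp)
    then have r2: "f ` A #>\<^bsub>K\<^esub> f (r (A #> c)) = f ` A #>\<^bsub>K\<^esub> f c" if "c \<in> C" for c
      using that iff by simp
    show "bij_betw (\<lambda>Y. f ` A #>\<^bsub>K\<^esub> f (r Y)) ((#>) A ` C) ((#>\<^bsub>K\<^esub>) (f ` A) ` f ` C)"
      unfolding bij_betw_def inj_on_def using r2 iff by (auto simp: image_image)
  qed
qed

end

section \<open>Homomorphisms into a cyclic group\<close>

text \<open>These stand for the homomorphisms out of the quotient of \<open>M\<close> by
  \<open>N\<close>. Keeping \<open>N\<close> as a vanishing condition allows \<open>M\<close> to
  grow inside a fixed group; extensionality makes each homomorphism occur once.\<close>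

abbreviation homs_killing where
  "homs_killing G M C N \<equiv> {\<phi> \<in> hom (G\<lparr>carrier := M\<rparr>) C \<inter> extensional M. \<forall>y\<in>N. \<phi> y = \<one>\<^bsub>C\<^esub>}"

context comm_group
begin

text \<open>All relations between \<open>x\<close> and \<open>M\<close> follow from the one
  expressing \<open>x [^] d\<close> in \<open>M\<close>, so the only constraint on the value
  \<open>t\<close> at \<open>x\<close> is the compatibility with that relation. Nothing is claimed
  about \<open>\<Phi>\<close> off the subgroup generated by \<open>M\<close> and
  \<open>x\<close>.\<close>

lemma hom_adjoin_extend:
  assumes M: "subgroup M G" and x: "x \<in> carrier G" and C: "comm_group C"
    and d: "\<And>j::int. x [^] j \<in> M \<longleftrightarrow> int d dvd j"
    and \<phi>: "\<phi> \<in> hom (G\<lparr>carrier := M\<rparr>) C"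
    and t: "t \<in> carrier C" "t [^]\<^bsub>C\<^esub> d = \<phi> (x [^] d)"
  obtains \<Phi> where "\<And>m j. m \<in> M \<Longrightarrow> \<Phi> (m \<otimes> x [^] (j::int)) = \<phi> m \<otimes>\<^bsub>C\<^esub> t [^]\<^bsub>C\<^esub> j"
proof -
  interpret M: subgroup M G by fact
  interpret C: comm_group C by fact
  interpret p: group_hom "G\<lparr>carrier := M\<rparr>" C \<phi>
    using subgroup.subgroup_is_group[OF M is_group] \<phi>
    by (simp add: group_hom_def group_hom_axioms_def C.is_group)
  have \<phi>M: "\<phi> m \<in> carrier C" if "m \<in> M" for m using p.hom_closed that by simp
  have \<phi>mult: "\<phi> (m \<otimes> m') = \<phi> m \<otimes>\<^bsub>C\<^esub> \<phi> m'" if "m \<in> M" "m' \<in> M" for m m'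
    using p.hom_mult that by simp
  have \<phi>pow: "\<phi> (m [^] (l::int)) = \<phi> m [^]\<^bsub>C\<^esub> l" if "m \<in> M" for m l
    using p.hom_int_pow[of m l] that int_pow_consistent[OF M, of m l] by simp
  \<comment> \<open>Well-definedness: two representations of the same element differ by a power of
    \<open>x\<close> lying in \<open>M\<close>. Its exponent is a multiple of \<open>d\<close>, and
    there the root condition on \<open>t\<close> applies.\<close>
  have wd: "\<phi> m \<otimes>\<^bsub>C\<^esub> t [^]\<^bsub>C\<^esub> j = \<phi> m' \<otimes>\<^bsub>C\<^esub> t [^]\<^bsub>C\<^esub> j'"
    if 1: "m \<in> M" "m' \<in> M" and eq: "m \<otimes> x [^] j = m' \<otimes> x [^] j'" for m m' and j j' :: int
  proof -
    have "m \<otimes> x [^] (j - j') = (m \<otimes> x [^] j) \<otimes> inv (x [^] j')"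
      using 1 x by (simp add: int_pow_diff m_assoc)
    also have "\<dots> = m'" using 1 x unfolding eq by (simp add: m_assoc)
    finally have m': "m' = m \<otimes> x [^] (j - j')" by simp
    then have "x [^] (j - j') = inv m \<otimes> m'" using 1 x by (simp add: m_assoc[symmetric])
    then have "x [^] (j - j') \<in> M" using 1 by simp
    then obtain l where l: "j - j' = int d * l" using d by blast
    have xd: "x [^] d \<in> M" using d[of "int d"] by (simp add: int_pow_int)
    have "x [^] (j - j') = (x [^] d) [^] l"
      using x by (simp add: l int_pow_pow[symmetric] int_pow_int)
    then have "\<phi> m' = \<phi> m \<otimes>\<^bsub>C\<^esub> (t [^]\<^bsub>C\<^esub> d) [^]\<^bsub>C\<^esub> l"
      using m' 1 xd t by (simp add: \<phi>mult \<phi>pow M.subgroup_axioms subgroup_int_pow_closed)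
    also have "(t [^]\<^bsub>C\<^esub> d) [^]\<^bsub>C\<^esub> l = t [^]\<^bsub>C\<^esub> (j - j')"
      using t by (simp add: l C.int_pow_pow[symmetric] int_pow_int)
    finally have "\<phi> m' \<otimes>\<^bsub>C\<^esub> t [^]\<^bsub>C\<^esub> j' = \<phi> m \<otimes>\<^bsub>C\<^esub> (t [^]\<^bsub>C\<^esub> (j - j') \<otimes>\<^bsub>C\<^esub> t [^]\<^bsub>C\<^esub> j')"
      using 1 t \<phi>M by (simp add: C.m_assoc)
    then show ?thesis using t by (simp flip: C.int_pow_mult)
  qed
  define \<Phi> where "\<Phi> y = (let (m, j) = (SOME (m, j::int). m \<in> M \<and> y = m \<otimes> x [^] j)
      in \<phi> m \<otimes>\<^bsub>C\<^esub> t [^]\<^bsub>C\<^esub> j)" for y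
  have "\<Phi> (m \<otimes> x [^] j) = \<phi> m \<otimes>\<^bsub>C\<^esub> t [^]\<^bsub>C\<^esub> j" if m: "m \<in> M" for m and j :: int
  proof -
    define p where "p = (SOME (m', j'::int). m' \<in> M \<and> m \<otimes> x [^] j = m' \<otimes> x [^] j')"
    have "case p of (m', j') \<Rightarrow> m' \<in> M \<and> m \<otimes> x [^] j = m' \<otimes> x [^] j'"
      unfolding p_def by (rule someI[of _ "(m, j)"]) (use m in simp)
    then obtain m' j' where p: "p = (m', j')" "m' \<in> M" "m \<otimes> x [^] j = m' \<otimes> x [^] j'"
      by (cases p) auto
    have "\<Phi> (m \<otimes> x [^] j) = \<phi> m' \<otimes>\<^bsub>C\<^esub> t [^]\<^bsub>C\<^esub> j'"
      using p(1) unfolding \<Phi>_def p_def by simp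
    then show ?thesis using wd[OF m p(2,3)] by simp
  qed
  then show thesis using that by blast
qed

text \<open>Restriction to \<open>M\<close> maps the homomorphisms on \<open>M'\<close> to those on
  \<open>M\<close>. The fibre over \<open>\<phi>\<close> is the set of admissible values at
  \<open>x\<close>, namely the \<open>d\<close>-th roots of \<open>\<phi> (x [^] d)\<close>, and by
  assumption there are \<open>d\<close> of them.\<close>

lemma card_homs_killing_adjoin:
  assumes M: "subgroup M G" and x: "x \<in> carrier G" and C: "comm_group C"
    and N: "N \<subseteq> M"
    and d: "\<And>j::int. x [^] j \<in> M \<longleftrightarrow> int d dvd j"
    and M': "M' = M <#> range (\<lambda>j::int. x [^] j)"
    and fin: "finite (homs_killing G M C N)"
    and roots: "\<And>\<phi>. \<phi> \<in> homs_killing G M C N \<Longrightarrow>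
      finite {t \<in> carrier C. t [^]\<^bsub>C\<^esub> d = \<phi> (x [^] d)} \<and> card {t \<in> carrier C. t [^]\<^bsub>C\<^esub> d = \<phi> (x [^] d)} = d"
  shows "finite (homs_killing G M' C N)"
    and "card (homs_killing G M' C N) = card (homs_killing G M C N) * d"
proof -
  interpret M: subgroup M G by fact
  interpret C: comm_group C by fact
  let ?T = "\<lambda>\<phi>. {t \<in> carrier C. t [^]\<^bsub>C\<^esub> d = \<phi> (x [^] d)}"
  let ?S = "SIGMA \<phi>:homs_killing G M C N. ?T \<phi>"
  let ?F = "\<lambda>\<Phi>. (restrict \<Phi> M, \<Phi> x)"
  have subM': "subgroup M' G"
    unfolding M' using M subgroup_of_powers[OF x] by (rule mult_subgroups)
  have mem: "y \<in> M' \<longleftrightarrow> (\<exists>m\<in>M. \<exists>j::int. y = m \<otimes> x [^] j)" for y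
    by (auto simp: M' set_mult_def)
  have memI: "m \<otimes> x [^] j \<in> M'" if "m \<in> M" for m and j :: int using that mem by blast
  have MM': "M \<subseteq> M'"
  proof
    fix m assume "m \<in> M"
    then show "m \<in> M'" using memI[of m 0] by simp
  qed
  have xM': "x \<in> M'" using memI[of \<one> 1] x by (simp add: int_pow_1)
  have decomp: "\<Phi> (m \<otimes> x [^] j) = \<Phi> m \<otimes>\<^bsub>C\<^esub> \<Phi> x [^]\<^bsub>C\<^esub> j"
    if \<Phi>: "\<Phi> \<in> hom (G\<lparr>carrier := M'\<rparr>) C" and m: "m \<in> M" for \<Phi> m and j :: int
  proof -
    interpret p: group_hom "G\<lparr>carrier := M'\<rparr>" C \<Phi>
      using subgroup.subgroup_is_group[OF subM' is_group] \<Phi>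
      by (simp add: group_hom_def group_hom_axioms_def C.is_group)
    have "\<Phi> (x [^] j) = \<Phi> x [^]\<^bsub>C\<^esub> j"
      using p.hom_int_pow[of x j] xM' int_pow_consistent[OF subM' xM', of j] by simp
    moreover have "x [^] j \<in> M'" using subgroup_int_pow_closed[OF subM' xM'] .
    ultimately show ?thesis using p.hom_mult[of m "x [^] j"] m MM' by auto
  qed
  \<comment> \<open>Injectivity of \<open>?F\<close> is \<open>decomp\<close>: the restriction and
    the value at \<open>x\<close> determine everything. Surjectivity is the extension lemma.\<close>
  have bij: "bij_betw ?F (homs_killing G M' C N) ?S"
  proof (rule bij_betwI')
    fix \<Phi> \<Psi> assume 1: "\<Phi> \<in> homs_killing G M' C N" "\<Psi> \<in> homs_killing G M' C N"
    show "(?F \<Phi> = ?F \<Psi>) = (\<Phi> = \<Psi>)"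
    proof
      assume eq: "?F \<Phi> = ?F \<Psi>"
      have eqM: "\<Phi> m = \<Psi> m" if "m \<in> M" for m
        using eq that by (metis Pair_inject restrict_apply')
      have eqx: "\<Phi> x = \<Psi> x" using eq by simp
      show "\<Phi> = \<Psi>"
      proof (rule extensionalityI)
        show "\<Phi> \<in> extensional M'" "\<Psi> \<in> extensional M'" using 1 by auto
        fix y assume "y \<in> M'"
        then obtain m j where "m \<in> M" "y = m \<otimes> x [^] (j::int)" using mem by blast
        then show "\<Phi> y = \<Psi> y"
          using decomp[of \<Phi> m j] decomp[of \<Psi> m j] eqM eqx 1 by simp
      qed
    qed simp
  next
    fix \<Phi> assume 1: "\<Phi> \<in> homs_killing G M' C N"
    have "restrict \<Phi> M \<in> homs_killing G M C N"
      using 1 MM' N by (auto simp: hom_def Pi_def subset_eq)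
    moreover have "\<Phi> x \<in> carrier C" using 1 xM' by (auto simp: hom_def)
    moreover have "\<Phi> x [^]\<^bsub>C\<^esub> d = \<Phi> (x [^] d)"
    proof -
      interpret p: group_hom "G\<lparr>carrier := M'\<rparr>" C \<Phi>
        using subgroup.subgroup_is_group[OF subM' is_group] 1
        by (simp add: group_hom_def group_hom_axioms_def C.is_group)
      show ?thesis using p.hom_nat_pow[of x d] xM' nat_pow_consistent[of x d M'] by simp
    qed
    moreover have "x [^] d \<in> M" using d[of "int d"] by (simp add: int_pow_int)
    ultimately show "?F \<Phi> \<in> ?S" by simp
  next
    fix p assume "p \<in> ?S"
    then obtain \<phi> t where p: "p = (\<phi>, t)" and \<phi>: "\<phi> \<in> homs_killing G M C N"
      and t: "t \<in> carrier C" "t [^]\<^bsub>C\<^esub> d = \<phi> (x [^] d)" by auto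
    have \<phi>': "\<phi> \<in> hom (G\<lparr>carrier := M\<rparr>) C" using \<phi> by simp
    obtain \<Phi>0 where \<Phi>0: "\<And>m j. m \<in> M \<Longrightarrow> \<Phi>0 (m \<otimes> x [^] (j::int)) = \<phi> m \<otimes>\<^bsub>C\<^esub> t [^]\<^bsub>C\<^esub> j"
      using hom_adjoin_extend[OF M x C d \<phi>' t] by blast
    have \<phi>M: "\<phi> m \<in> carrier C" if "m \<in> M" for m using \<phi>' that by (auto simp: hom_def)
    have \<phi>mult: "\<phi> (m \<otimes> m') = \<phi> m \<otimes>\<^bsub>C\<^esub> \<phi> m'" if "m \<in> M" "m' \<in> M" for m m'
      using \<phi>' that by (auto simp: hom_def)
    have \<Phi>M: "\<Phi>0 m = \<phi> m" if "m \<in> M" for m using \<Phi>0[of m 0] that \<phi>M by simp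
    have \<phi>1: "\<phi> \<one> = \<one>\<^bsub>C\<^esub>"
      using \<phi>mult[of \<one> \<one>] \<phi>M[of \<one>] by (simp add: C.l_cancel_one')
    have \<Phi>x: "\<Phi>0 x = t" using \<Phi>0[of \<one> 1] x t by (simp add: int_pow_1 \<phi>1 C.int_pow_1)
    define \<Phi> where "\<Phi> = restrict \<Phi>0 M'"
    have mult: "\<Phi>0 (y \<otimes> z) = \<Phi>0 y \<otimes>\<^bsub>C\<^esub> \<Phi>0 z" if yzM: "y \<in> M'" "z \<in> M'" for y z
    proof -
      obtain m m' j j' where yz: "m \<in> M" "y = m \<otimes> x [^] (j::int)" "m' \<in> M" "z = m' \<otimes> x [^] (j'::int)"
        using yzM unfolding mem by blast
      have "y \<otimes> z = (m \<otimes> m') \<otimes> x [^] (j + j')"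
        using yz x by (simp add: int_pow_mult m_ac)
      then have "\<Phi>0 (y \<otimes> z) = (\<phi> m \<otimes>\<^bsub>C\<^esub> \<phi> m') \<otimes>\<^bsub>C\<^esub> t [^]\<^bsub>C\<^esub> (j + j')"
        using \<Phi>0[of "m \<otimes> m'"] yz \<phi>mult by simp
      also have "\<dots> = (\<phi> m \<otimes>\<^bsub>C\<^esub> t [^]\<^bsub>C\<^esub> j) \<otimes>\<^bsub>C\<^esub> (\<phi> m' \<otimes>\<^bsub>C\<^esub> t [^]\<^bsub>C\<^esub> j')"
        using yz t \<phi>M by (simp add: C.int_pow_mult C.m_ac)
      finally show ?thesis using \<Phi>0 yz by simp
    qed
    have "\<Phi>0 y \<in> carrier C" if "y \<in> M'" for y
      using that mem \<Phi>0 \<phi>M t by (metis C.int_pow_closed C.m_closed)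
    then have "\<Phi> \<in> hom (G\<lparr>carrier := M'\<rparr>) C"
      using mult subgroup.m_closed[OF subM'] by (auto simp: hom_def \<Phi>_def)
    moreover have "\<forall>y\<in>N. \<Phi> y = \<one>\<^bsub>C\<^esub>" using \<phi> \<Phi>M N MM' by (auto simp: \<Phi>_def)
    ultimately have "\<Phi> \<in> homs_killing G M' C N" by (simp add: \<Phi>_def)
    moreover have "restrict \<Phi> M = \<phi>"
    proof (rule extensionalityI[of _ M])
      show "\<phi> \<in> extensional M" using \<phi> by simp
      show "\<And>y. y \<in> M \<Longrightarrow> restrict \<Phi> M y = \<phi> y" using \<Phi>M MM' by (auto simp: \<Phi>_def)
    qed simp
    ultimately show "\<exists>\<Phi>\<in>homs_killing G M' C N. p = ?F \<Phi>"
      using p \<Phi>x xM' by (intro bexI[of _ \<Phi>]) (simp_all add: \<Phi>_def)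
  qed
  have "finite ?S" using fin roots by (intro finite_SigmaI) auto
  then show "finite (homs_killing G M' C N)" using bij_betw_finite[OF bij] by blast
  have "card ?S = (\<Sum>\<phi>\<in>homs_killing G M C N. card (?T \<phi>))"
    using fin roots by (intro card_SigmaI) auto
  also have "\<dots> = card (homs_killing G M C N) * d" using roots by simp
  finally show "card (homs_killing G M' C N) = card (homs_killing G M C N) * d"
    using bij_betw_same_card[OF bij] by simp
qed

text \<open>The cosets are those of the powers of \<open>x\<close>, and the exponent matters modulo
  \<open>d\<close> only. This is the same factor \<open>d\<close> by which the number of
  homomorphisms grows.\<close>

lemma card_cosets_adjoin:
  assumes M: "subgroup M G" and x: "x \<in> carrier G" and d0: "d > 0"
    and d: "\<And>j::int. x [^] j \<in> M \<longleftrightarrow> int d dvd j"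
  shows "card ((#>) M ` (M <#> range (\<lambda>j::int. x [^] j))) = d"
proof -
  interpret M: subgroup M G by fact
  have eq: "M #> x [^] i = M #> x [^] j \<longleftrightarrow> int d dvd i - j" for i j :: int
    using x d by (simp add: rcos_eq_iff[OF M] flip: int_pow_diff)
  have m: "M #> (m \<otimes> y) = M #> y" if "m \<in> M" "y \<in> carrier G" for m y
    using that by (simp add: rcos_eq_iff[OF M] m_assoc)
  have "(#>) M ` (M <#> range (\<lambda>j::int. x [^] j)) = (\<lambda>j. M #> x [^] j) ` {0..<int d}"
  proof (intro equalityI subsetI)
    fix Y assume "Y \<in> (#>) M ` (M <#> range (\<lambda>j::int. x [^] j))"
    then obtain k j where "k \<in> M" "Y = M #> (k \<otimes> x [^] (j::int))"
      by (auto simp: set_mult_def)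
    then have "Y = M #> x [^] (j mod int d)" using m x eq by (simp add: minus_mod_eq_mult_div)
    then show "Y \<in> (\<lambda>j. M #> x [^] j) ` {0..<int d}" using d0 by simp
  next
    fix Y assume "Y \<in> (\<lambda>j. M #> x [^] j) ` {0..<int d}"
    then obtain j :: int where "Y = M #> (\<one> \<otimes> x [^] j)" using x by auto
    moreover have "\<one> \<otimes> x [^] j \<in> M <#> range (\<lambda>j::int. x [^] j)"
      unfolding set_mult_def using M.one_closed by blast
    ultimately show "Y \<in> (#>) M ` (M <#> range (\<lambda>j::int. x [^] j))" by blast
  qed
  moreover have "inj_on (\<lambda>j. M #> x [^] j) {0..<int d}"
  proof (rule inj_onI)
    fix i j assume 1: "i \<in> {0..<int d}" "j \<in> {0..<int d}" "M #> x [^] i = M #> x [^] j"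
    then have "int d dvd i - j" using eq by simp
    then have "i mod int d = j mod int d" by (simp add: mod_eq_dvd_iff)
    then show "i = j" using 1 by simp
  qed
  ultimately show ?thesis by (simp add: card_image)
qed

end

text \<open>Write \<open>n = d * e\<close>. The condition \<open>c0\<close> says that
  \<open>d * e\<close> divides \<open>e * c\<close>, hence \<open>c = d * c'\<close>. The equation
  for \<open>t\<close> then becomes congruence to \<open>c'\<close> modulo \<open>e\<close>, which
  has \<open>d\<close> solutions modulo \<open>n\<close>.\<close>

lemma card_roots_integer_mod_group:
  assumes n: "n > 0" and d: "d dvd n" and c: "c \<in> carrier (integer_mod_group n)"
    and c0: "c [^]\<^bsub>integer_mod_group n\<^esub> (n div d) = \<one>\<^bsub>integer_mod_group n\<^esub>"
  shows "card {t \<in> carrier (integer_mod_group n). t [^]\<^bsub>integer_mod_group n\<^esub> d = c} = d"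
proof -
  obtain e where e: "n = d * e" using d by blast
  have pos: "d > 0" "e > 0" using n e by auto
  have "int (d * e) dvd int e * c"
    using c0 e pos by (simp add: mod_eq_0_iff_dvd)
  then have "int e * int d dvd int e * c" by (simp add: mult.commute)
  then have "int d dvd c" using pos by (subst (asm) dvd_mult_cancel_left) auto
  then obtain c' where c': "c = int d * c'" by blast
  have cr: "0 \<le> c" "c < int d * int e" using c n e by (auto simp: carrier_integer_mod_group)
  then have c'r: "0 \<le> c'" "c' < int e" using c' pos by (auto simp: zero_le_mult_iff)
  have "{t \<in> carrier (integer_mod_group n). t [^]\<^bsub>integer_mod_group n\<^esub> d = c}
      = (\<lambda>j. c' + j * int e) ` {0..<int d}"
  proof (intro equalityI subsetI)
    fix t assume "t \<in> {t \<in> carrier (integer_mod_group n). t [^]\<^bsub>integer_mod_group n\<^esub> d = c}"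
    then have t: "0 \<le> t" "t < int d * int e" "(int d * t) mod (int d * int e) = int d * c'"
      using n e c' by (auto simp: carrier_integer_mod_group)
    then have "t mod int e = c'" using pos by (simp add: mult_mod_right[symmetric])
    then have teq: "t = c' + (t div int e) * int e" by (metis add.commute div_mult_mod_eq)
    have "0 \<le> t div int e" using t pos by (simp add: pos_imp_zdiv_nonneg_iff)
    moreover have "(t div int e) * int e < int d * int e"
      using t(2) c'r(1) teq by linarith
    then have "t div int e < int d" using pos by (simp only: mult_less_cancel_right_pos of_nat_0_less_iff)
    ultimately show "t \<in> (\<lambda>j. c' + j * int e) ` {0..<int d}" using teq by auto
  next
    fix t assume "t \<in> (\<lambda>j. c' + j * int e) ` {0..<int d}"
    then obtain j where j: "0 \<le> j" "j < int d" "t = c' + j * int e" by auto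
    have "0 \<le> t" using j c'r by simp
    moreover have "t < int d * int e"
    proof -
      have "t < (j + 1) * int e" using j c'r by (simp add: algebra_simps)
      also have "\<dots> \<le> int d * int e" using j by (intro mult_right_mono) auto
      finally show ?thesis .
    qed
    moreover have "(int d * t) mod (int d * int e) = int d * c'"
      using j c'r by (simp add: mult_mod_right[symmetric])
    ultimately show "t \<in> {t \<in> carrier (integer_mod_group n). t [^]\<^bsub>integer_mod_group n\<^esub> d = c}"
      using n e c' by (simp add: carrier_integer_mod_group)
  qed
  moreover have "inj_on (\<lambda>j. c' + j * int e) {0..<int d}" using pos by (auto simp: inj_on_def)
  ultimately show ?thesis by (simp add: card_image)
qed

context comm_group
begin

text \<open>The exponents carrying \<open>x\<close> into \<open>M\<close> form a subgroup of the
  integers. It contains \<open>n\<close>, so it is nonzero and generated by its least positive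
  element \<open>d\<close>.\<close>

lemma subgroup_power_period:
  assumes M: "subgroup M G" and x: "x \<in> carrier G" and n: "n > 0" "x [^] (n::nat) \<in> M"
  obtains d where "d > 0" "d dvd n" "\<And>j::int. x [^] j \<in> M \<longleftrightarrow> int d dvd j"
proof -
  interpret M: subgroup M G by fact
  define d where "d = (LEAST d::nat. 0 < d \<and> x [^] d \<in> M)"
  have d: "0 < d" "x [^] d \<in> M"
    using LeastI[of "\<lambda>d::nat. 0 < d \<and> x [^] d \<in> M" n] n by (auto simp: d_def)
  have xd: "x [^] (int d * l) \<in> M" for l
    using subgroup_int_pow_closed[OF M d(2), of l] x by (simp flip: int_pow_int int_pow_pow)
  have iff: "x [^] j \<in> M \<longleftrightarrow> int d dvd j" for j :: int
  proof
    assume j: "x [^] j \<in> M"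
    \<comment> \<open>Division with remainder: the remainder of \<open>j\<close> is again such an
      exponent and is smaller than \<open>d\<close>, so minimality forces it to be zero.\<close>
    have "x [^] (j mod int d) = x [^] j \<otimes> x [^] (int d * (- (j div int d)))"
      using x by (simp add: minus_div_mult_eq_mod[symmetric] mult.commute flip: int_pow_mult)
    then have "x [^] (j mod int d) \<in> M" using M.m_closed[OF j xd] by (simp only:)
    then have in_M: "x [^] nat (j mod int d) \<in> M" using d by (simp flip: int_pow_int)
    have less: "nat (j mod int d) < d" using d by (simp add: nat_less_iff)
    have "\<not> (0 < i \<and> x [^] i \<in> M)" if "i < d" for i
      using that unfolding d_def by (rule not_less_Least)
    from this[OF less] in_M have "\<not> 0 < nat (j mod int d)" by iprover
    then have "nat (j mod int d) = 0" by (simp only: not_gr_zero)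
    moreover have "0 \<le> j mod int d" using d by simp
    ultimately have "j mod int d = 0" by linarith
    then show "int d dvd j" by presburger
  qed (use xd in blast)
  have "d dvd n" using iff[of "int n"] n by (simp add: int_pow_int)
  then show thesis using that d iff by blast
qed

lemma coset_self_image:
  assumes N: "subgroup N G"
  shows "(#>) N ` N = {N}"
proof -
  have "N #> x = N" if "x \<in> N" for x
    using coset_join2[OF subgroup.mem_carrier[OF N that] N that] .
  then show ?thesis using subgroup.one_closed[OF N] by auto
qed

text \<open>Adjoin elements to \<open>N\<close> one at a time. The number of homomorphisms and the
  index of \<open>N\<close> both start at 1, and each step multiplies both by the same period
  \<open>d\<close>. The assumption \<open>pow\<close> makes every period divide \<open>n\<close> and
  makes the required roots exist.\<close>

lemma card_homs_killing_integer_mod_group: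
  assumes S: "finite S" "S \<subseteq> carrier G" "generate G S = carrier G"
    and N: "subgroup N G" and n: "n > 0" and pow: "\<And>y. y \<in> carrier G \<Longrightarrow> y [^] n \<in> N"
  shows "card (homs_killing G (carrier G) (integer_mod_group n) N) = card ((#>) N ` carrier G)"
proof -
  let ?C = "integer_mod_group n"
  \<comment> \<open>The subgroup is only asked to contain \<open>Y\<close>. For a generating set it
    must be all of \<open>G\<close>, which gives the claim.\<close>
  have ex: "\<exists>M. subgroup M G \<and> N \<subseteq> M \<and> Y \<subseteq> M \<and> finite (homs_killing G M ?C N)
      \<and> card (homs_killing G M ?C N) = card ((#>) N ` M)"
    if "finite Y" "Y \<subseteq> carrier G" for Y
    using that
  proof (induction Y rule: finite_induct)
    case empty
    have "homs_killing G N ?C N = {\<lambda>y\<in>N. 0}"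
    proof (intro equalityI subsetI)
      fix \<phi> assume "\<phi> \<in> homs_killing G N ?C N"
      then show "\<phi> \<in> {\<lambda>y\<in>N. 0}" by (auto simp: extensional_def)
    qed (use N in \<open>auto simp: hom_def subgroup.m_closed\<close>)
    then show ?case using N coset_self_image[OF N] by (intro exI[of _ N]) auto
  next
    case (insert x Y)
    then obtain M where M: "subgroup M G" "N \<subseteq> M" "Y \<subseteq> M" "finite (homs_killing G M ?C N)"
      "card (homs_killing G M ?C N) = card ((#>) N ` M)" by auto
    interpret M: subgroup M G by fact
    have x: "x \<in> carrier G" using insert by simp
    obtain d where d: "d > 0" "d dvd n" "\<And>j::int. x [^] j \<in> M \<longleftrightarrow> int d dvd j"
      using subgroup_power_period[OF M(1) x n] pow[OF x] M(2) by blast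
    define M' where "M' = M <#> range (\<lambda>j::int. x [^] j)"
    have M': "subgroup M' G"
      unfolding M'_def using M(1) subgroup_of_powers[OF x] by (rule mult_subgroups)
    have MM': "M \<subseteq> M'"
    proof
      fix m assume "m \<in> M"
      then have "m = m \<otimes> x [^] (0::int)" by simp
      then show "m \<in> M'" unfolding M'_def set_mult_def using \<open>m \<in> M\<close> by blast
    qed
    have "x = \<one> \<otimes> x [^] (1::int)" using x by (simp add: int_pow_1)
    then have xM': "x \<in> M'" unfolding M'_def set_mult_def using M.one_closed by blast
    have roots: "finite {t \<in> carrier ?C. t [^]\<^bsub>?C\<^esub> d = \<phi> (x [^] d)} \<and>
        card {t \<in> carrier ?C. t [^]\<^bsub>?C\<^esub> d = \<phi> (x [^] d)} = d"
      if \<phi>: "\<phi> \<in> homs_killing G M ?C N" for \<phi>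
    proof -
      interpret p: group_hom "G\<lparr>carrier := M\<rparr>" ?C \<phi>
        using subgroup.subgroup_is_group[OF M(1) is_group] \<phi>
        by (simp add: group_hom_def group_hom_axioms_def)
      have xd: "x [^] d \<in> M" using d(3)[of "int d"] by (simp add: int_pow_int)
      \<comment> \<open>Since \<open>x [^] n\<close> lies in \<open>N\<close>, the power with
        exponent \<open>n div d\<close> is trivial. This is the criterion for having
        \<open>d\<close>-th roots in a cyclic group of order \<open>n\<close>.\<close>
      have "\<phi> (x [^] d) [^]\<^bsub>?C\<^esub> (n div d) = \<phi> ((x [^] d) [^] (n div d))"
        using p.hom_nat_pow[of "x [^] d" "n div d"] xd nat_pow_consistent[of "x [^] d" "n div d" M]
        by simp
      also have "(x [^] d) [^] (n div d) = x [^] n" using x d(2) by (simp add: nat_pow_pow)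
      also have "\<phi> (x [^] n) = \<one>\<^bsub>?C\<^esub>" using \<phi> pow[OF x] by blast
      finally have "card {t \<in> carrier ?C. t [^]\<^bsub>?C\<^esub> d = \<phi> (x [^] d)} = d"
        using card_roots_integer_mod_group[OF n d(2)] p.hom_closed xd by auto
      \<comment> \<open>An infinite set has \<open>card\<close> 0, so a positive cardinality already
        implies finiteness.\<close>
      then show ?thesis using d(1) by (metis card.infinite less_irrefl)
    qed
    note adjoin = card_homs_killing_adjoin[OF M(1) x abelian_integer_mod_group[of n] M(2) d(3) M'_def M(4)]
    have adj: "finite (homs_killing G M' ?C N)"
      "card (homs_killing G M' ?C N) = card (homs_killing G M ?C N) * d"
      by (rule adjoin(1), erule roots) (rule adjoin(2), erule roots)
    have "card ((#>) N ` M') = card ((#>) M ` M' \<times> (#>) N ` M)"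
      using cosets_tower_eqpoll[OF N M(1) M' M(2) MM'] unfolding eqpoll_def
      using bij_betw_same_card by blast
    also have "\<dots> = d * card (homs_killing G M ?C N)"
      using card_cosets_adjoin[OF M(1) x d(1,3)] M(5) by (simp add: card_cartesian_product M'_def)
    finally have "card (homs_killing G M' ?C N) = card ((#>) N ` M')" using adj(2) by simp
    then show ?case using adj(1) M' MM' M(2,3) xM' by (intro exI[of _ M']) auto
  qed
  from ex[OF S(1,2)] obtain M where M: "subgroup M G" "S \<subseteq> M"
    "card (homs_killing G M ?C N) = card ((#>) N ` M)" by (elim exE conjE)
  have "carrier G \<subseteq> M" using generate_subgroup_incl[OF M(2,1)] S by simp
  then have "M = carrier G" using subgroup.subset[OF M(1)] by blast
  then show ?thesis using M(3) by simp
qed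

end

section \<open>Independent sets and rank\<close>

context comm_group
begin

section \<open>Integer linear combinations\<close>

lemma finprod_in_subgroup:
  assumes B: "subgroup B G" and f: "f \<in> A \<rightarrow> B"
  shows "finprod G f A \<in> B"
  using f
proof (induction A rule: infinite_finite_induct)
  case (insert x A)
  interpret B: subgroup B G by fact
  have "f \<in> A \<rightarrow> carrier G" "f x \<in> carrier G" using insert.prems B.mem_carrier by (blast, blast)
  then show ?case using insert by (auto simp: Pi_iff)
qed (use B subgroup.one_closed in auto)

text \<open>The integer linear combination with coefficients \<open>c\<close>, in multiplicative
  notation. It turns questions about independence, spans and cosets into questions about coefficient
  functions.\<close>

definition int_comb :: "'a set \<Rightarrow> ('a \<Rightarrow> int) \<Rightarrow> 'a" where
  "int_comb S c = (\<Otimes>x\<in>S. x [^] c x)"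

lemma int_comb_closed [simp]: "S \<subseteq> carrier G \<Longrightarrow> int_comb S c \<in> carrier G"
  by (auto simp: int_comb_def intro!: finprod_closed)

lemma int_comb_cong:
  "S \<subseteq> carrier G \<Longrightarrow> (\<And>x. x \<in> S \<Longrightarrow> c x = d x) \<Longrightarrow> int_comb S c = int_comb S d"
  unfolding int_comb_def by (intro finprod_cong') auto

lemma int_comb_add:
  "S \<subseteq> carrier G \<Longrightarrow> int_comb S (\<lambda>x. c x + d x) = int_comb S c \<otimes> int_comb S d"
  unfolding int_comb_def
  by (subst finprod_multf[symmetric]) (auto simp: int_pow_mult intro!: finprod_cong')

lemma int_comb_scale:
  assumes "S \<subseteq> carrier G"
  shows "int_comb S (\<lambda>x. k * c x) = int_comb S c [^] (k::int)"
  using assms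
proof (induction S rule: infinite_finite_induct)
  case (insert x S)
  then have "(\<lambda>y. y [^] (k * c y)) \<in> S \<rightarrow> carrier G" "(\<lambda>y. y [^] c y) \<in> S \<rightarrow> carrier G" by auto
  then show ?case using insert int_comb_closed[of S]
    by (simp add: int_comb_def int_pow_distrib int_pow_pow mult.commute)
qed (auto simp: int_comb_def)

lemma int_comb_diff:
  assumes S: "S \<subseteq> carrier G"
  shows "int_comb S (\<lambda>x. c x - d x) = int_comb S c \<otimes> inv (int_comb S d)"
  using int_comb_add[OF S, of c "\<lambda>x. - 1 * d x"] int_comb_scale[OF S, of "-1" d] S
  by (simp add: int_pow_neg int_pow_1)

lemma int_comb_Un:
  assumes "finite S" "finite T" "S \<inter> T = {}" "S \<subseteq> carrier G" "T \<subseteq> carrier G"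
  shows "int_comb (S \<union> T) c = int_comb S c \<otimes> int_comb T c"
  unfolding int_comb_def using assms by (intro finprod_Un_disjoint) auto

lemma int_comb_single:
  assumes "finite S" "S \<subseteq> carrier G" "x \<in> S"
  shows "int_comb S (\<lambda>y. if y = x then k else 0) = x [^] k"
proof -
  have "int_comb S (\<lambda>y. if y = x then k else 0) = (\<Otimes>y\<in>S. if x = y then y [^] k else \<one>)"
    unfolding int_comb_def using assms by (intro finprod_cong') auto
  also have "\<dots> = x [^] k" using assms by (intro finprod_singleton) auto
  finally show ?thesis .
qed

lemma generate_eq_int_combs:
  assumes S: "finite S" "S \<subseteq> carrier G"
  shows "generate G S = range (int_comb S)"
proof
  have "subgroup (range (int_comb S)) G"
  proof (rule subgroupI)
    fix y assume "y \<in> range (int_comb S)"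
    then obtain c where "y = int_comb S c" by blast
    then have "inv y = int_comb S (\<lambda>x. - 1 * c x)"
      using S by (subst int_comb_scale) (auto simp: int_pow_neg int_pow_1)
    then show "inv y \<in> range (int_comb S)" by blast
  next
    fix y z assume "y \<in> range (int_comb S)" "z \<in> range (int_comb S)"
    then obtain c d where "y = int_comb S c" "z = int_comb S d" by blast
    then have "y \<otimes> z = int_comb S (\<lambda>x. c x + d x)" using S by (simp add: int_comb_add)
    then show "y \<otimes> z \<in> range (int_comb S)" by blast
  qed (use S in auto)
  moreover have "x \<in> range (int_comb S)" if "x \<in> S" for x
    using int_comb_single[OF S that, of 1] S that by (metis int_pow_1 rangeI subsetD)
  ultimately show "generate G S \<subseteq> range (int_comb S)"
    by (intro generate_subgroup_incl) auto
  show "range (int_comb S) \<subseteq> generate G S"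
    unfolding int_comb_def using generate_is_subgroup[OF S(2)]
    by (blast intro: finprod_in_subgroup subgroup_int_pow_closed generate.incl)
qed

lemma int_independent_iff:
  "int_independent G S \<longleftrightarrow> S \<subseteq> carrier G \<and> finite S \<and> (\<forall>c. int_comb S c = \<one> \<longrightarrow> (\<forall>x\<in>S. c x = 0))"
  by (simp add: int_independent_def int_comb_def)

lemma int_comb_inj:
  assumes S: "int_independent G S" and eq: "int_comb S c = int_comb S d" and x: "x \<in> S"
  shows "c x = d x"
proof -
  have "S \<subseteq> carrier G" using S by (simp add: int_independent_iff)
  then have "int_comb S (\<lambda>x. c x - d x) = \<one>" using eq by (simp add: int_comb_diff)
  then show ?thesis using S x by (fastforce simp: int_independent_iff)
qed

section \<open>Index of the subgroup of powers, and torsion\<close>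

lemma group_hom_nat_pow: "group_hom G G (\<lambda>x. x [^] (n::nat))"
  by unfold_locales (auto simp: hom_def nat_pow_distrib)

text \<open>Independence makes coefficients unique, so a combination is an \<open>n\<close>-th power
  within the span exactly when \<open>n\<close> divides all its coefficients. The cosets are thus
  the coefficient functions modulo \<open>n\<close>, represented by functions from \<open>S\<close>
  to \<open>{0..<n}\<close>.\<close>

lemma card_cosets_powers_independent:
  assumes S: "int_independent G S" and n: "n > 0"
  shows "card ((#>) ((\<lambda>x. x [^] n) ` generate G S) ` generate G S) = n ^ card S"
proof -
  have fin: "finite S" "S \<subseteq> carrier G" using S by (auto simp: int_independent_iff)
  let ?F = "generate G S"
  let ?nF = "(\<lambda>x. x [^] n) ` ?F"
  have F: "subgroup ?F G" using generate_is_subgroup[OF fin(2)] .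
  have nF: "subgroup ?nF G"
    using group_hom.subgroup_img_is_subgroup[OF group_hom_nat_pow F] .
  have pow: "int_comb S c [^] n = int_comb S (\<lambda>x. int n * c x)" for c
    using fin by (simp add: int_comb_scale int_pow_int)
  have nF_eq: "?nF = range (\<lambda>e. int_comb S (\<lambda>x. int n * e x))"
    by (simp add: generate_eq_int_combs[OF fin] image_image pow)
  have eq: "?nF #> int_comb S c = ?nF #> int_comb S d \<longleftrightarrow> (\<forall>x\<in>S. int n dvd c x - d x)" for c d
  proof -
    have "?nF #> int_comb S c = ?nF #> int_comb S d \<longleftrightarrow> int_comb S (\<lambda>x. c x - d x) \<in> ?nF"
      using fin by (simp add: rcos_eq_iff[OF nF] int_comb_diff)
    also have "\<dots> \<longleftrightarrow> (\<exists>e. int_comb S (\<lambda>x. c x - d x) = int_comb S (\<lambda>x. int n * e x))"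
      unfolding nF_eq by blast
    also have "\<dots> \<longleftrightarrow> (\<exists>e. \<forall>x\<in>S. c x - d x = int n * e x)"
      using int_comb_inj[OF S] int_comb_cong[OF fin(2)] by meson
    also have "\<dots> \<longleftrightarrow> (\<forall>x\<in>S. int n dvd c x - d x)"
      unfolding dvd_def by metis
    finally show ?thesis .
  qed
  have "bij_betw (\<lambda>c. ?nF #> int_comb S c) (S \<rightarrow>\<^sub>E {0..<int n}) ((#>) ?nF ` ?F)"
    unfolding bij_betw_def
  proof
    show "inj_on (\<lambda>c. ?nF #> int_comb S c) (S \<rightarrow>\<^sub>E {0..<int n})"
    proof (rule inj_onI)
      fix c d assume 1: "c \<in> S \<rightarrow>\<^sub>E {0..<int n}" "d \<in> S \<rightarrow>\<^sub>E {0..<int n}"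
        "?nF #> int_comb S c = ?nF #> int_comb S d"
      have "c x = d x" if "x \<in> S" for x
      proof -
        have "c x mod int n = d x mod int n" using 1(3) that by (simp add: eq mod_eq_dvd_iff)
        moreover have "c x \<in> {0..<int n}" "d x \<in> {0..<int n}" using 1(1,2) that by auto
        ultimately show ?thesis by simp
      qed
      then show "c = d" using 1(1,2) by (meson PiE_ext)
    qed
    show "(\<lambda>c. ?nF #> int_comb S c) ` (S \<rightarrow>\<^sub>E {0..<int n}) = (#>) ?nF ` ?F"
    proof (intro equalityI subsetI)
      fix Y assume "Y \<in> (#>) ?nF ` ?F"
      then obtain c where Y: "Y = ?nF #> int_comb S c" by (auto simp: generate_eq_int_combs[OF fin])
      have "Y = ?nF #> int_comb S (\<lambda>x\<in>S. c x mod int n)"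
        unfolding Y eq by (simp add: minus_mod_eq_mult_div)
      moreover have "(\<lambda>x\<in>S. c x mod int n) \<in> S \<rightarrow>\<^sub>E {0..<int n}" using n by auto
      ultimately show "Y \<in> (\<lambda>c. ?nF #> int_comb S c) ` (S \<rightarrow>\<^sub>E {0..<int n})" by blast
    qed (auto simp: generate_eq_int_combs[OF fin])
  qed
  then have "card ((#>) ?nF ` ?F) = card (S \<rightarrow>\<^sub>E {0..<int n})" by (metis bij_betw_same_card)
  also have "\<dots> = n ^ card S" using fin by (simp add: card_PiE)
  finally show ?thesis .
qed

text \<open>Taking the \<open>n\<close>-th power multiplies all coefficients by \<open>n\<close>,
  and the integers have no zero divisors.\<close>

lemma independent_torsion_free:
  assumes S: "int_independent G S" and y: "y \<in> generate G S" and n: "n > 0" "y [^] (n::nat) = \<one>"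
  shows "y = \<one>"
proof -
  have fin: "finite S" "S \<subseteq> carrier G" using S by (auto simp: int_independent_iff)
  obtain c where c: "y = int_comb S c" using y by (auto simp: generate_eq_int_combs[OF fin])
  have "int_comb S (\<lambda>x. int n * c x) = \<one>"
    using fin n(2) c by (simp add: int_comb_scale int_pow_int)
  then have "\<forall>x\<in>S. int n * c x = 0" using S unfolding int_independent_iff by blast
  then have "\<forall>x\<in>S. c x = 0" using n by simp
  then have "int_comb S c = int_comb S (\<lambda>x. 0)" using fin by (intro int_comb_cong) auto
  then show ?thesis using fin c by (simp add: int_comb_def)
qed

text \<open>Writing \<open>F\<close> for the free subgroup generated by \<open>S\<close>, this compares the chains
  \<open>nF \<le> F \<le> G\<close> and \<open>nF \<le> nG \<le> G\<close>, using \<open>[nG : nF] |G[n]| = [G : F]\<close>.\<close>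
lemma card_cosets_powers:
  assumes S: "int_independent G S" and fin: "finite ((#>) (generate G S) ` carrier G)"
    and n: "n > 0"
  shows "finite {t \<in> carrier G. t [^] n = \<one>}"
    and "card ((#>) ((\<lambda>x. x [^] n) ` carrier G) ` carrier G) =
      n ^ card S * card {t \<in> carrier G. t [^] n = \<one>}"
proof -
  let ?T = "{t \<in> carrier G. t [^] n = \<one>}"
  let ?p = "\<lambda>x. x [^] n" and ?F = "generate G S"
  have F: "subgroup ?F G"
    using generate_is_subgroup S by (simp add: int_independent_iff)
  note img = group_hom.subgroup_img_is_subgroup[OF group_hom_nat_pow]
  have sub: "?p ` ?F \<subseteq> ?F" by (metis F image_subsetI int_pow_int subgroup_int_pow_closed)
  have sub2: "?p ` ?F \<subseteq> ?p ` carrier G" "?F \<subseteq> carrier G" "?p ` carrier G \<subseteq> carrier G"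
    using subgroup.subset[OF F] by auto
  \<comment> \<open>Here \<open>?T\<close> is the kernel of \<open>?p\<close>, and it meets
    \<open>?F\<close> trivially because \<open>?F\<close> is torsion-free.\<close>
  have i1: "(#>) ?F ` carrier G \<approx> ((#>) (?p ` ?F) ` ?p ` carrier G) \<times> ?T"
    using independent_torsion_free[OF S _ n] sub2
    by (intro cosets_hom_image_eqpoll group_hom_nat_pow F subgroup_self) auto
  have i2: "(#>) (?p ` ?F) ` carrier G \<approx> ((#>) ?F ` carrier G) \<times> ((#>) (?p ` ?F) ` ?F)"
    by (intro cosets_tower_eqpoll img F subgroup_self sub sub2)
  have i3: "(#>) (?p ` ?F) ` carrier G \<approx>
      ((#>) (?p ` carrier G) ` carrier G) \<times> ((#>) (?p ` ?F) ` ?p ` carrier G)"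
    by (intro cosets_tower_eqpoll img F subgroup_self sub2)
  have cardeq: "card A = card B" if "A \<approx> B" for A :: "'x set" and B :: "'y set"
    using that bij_betw_same_card unfolding eqpoll_def by blast
  have finprod: "finite (((#>) (?p ` ?F) ` ?p ` carrier G) \<times> ?T)"
    using eqpoll_finite_iff[OF i1] fin by blast
  have "\<one> \<in> ?T" by simp
  have ne: "(#>) (?p ` ?F) ` ?p ` carrier G \<noteq> {}" by blast
  show "finite ?T" by (rule finite_cartesian_productD2[OF finprod ne])
  have finm: "finite ((#>) (?p ` ?F) ` ?p ` carrier G)"
    using \<open>\<one> \<in> ?T\<close> by (intro finite_cartesian_productD1[OF finprod]) blast
  \<comment> \<open>The index of \<open>nF\<close> in \<open>G\<close> is evaluated along both
    chains, and the index of \<open>F\<close> is replaced using \<open>i1\<close>. The common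
    factor, the index of \<open>nF\<close> in \<open>nG\<close>, is finite and nonzero, hence
    cancels.\<close>
  have "card ((#>) (?p ` carrier G) ` carrier G) * card ((#>) (?p ` ?F) ` ?p ` carrier G)
      = (card ((#>) (?p ` ?F) ` ?p ` carrier G) * card ?T) * n ^ card S"
    using cardeq[OF i1] cardeq[OF i2] cardeq[OF i3] card_cosets_powers_independent[OF S n]
    by (simp add: card_cartesian_product)
  moreover have "card ((#>) (?p ` ?F) ` ?p ` carrier G) \<noteq> 0" using finm ne by simp
  ultimately show "card ((#>) (?p ` carrier G) ` carrier G) = n ^ card S * card ?T"
    by simp
qed

text \<open>Two torsion elements in the same coset of the free subgroup differ by a torsion element
  of it, which is trivial. So torsion injects into a finite set of cosets.\<close>

lemma finite_torsion_subgroup: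
  assumes S: "int_independent G S" and fin: "finite ((#>) (generate G S) ` carrier G)"
  shows "finite (torsion_subgroup G)"
proof -
  have F: "subgroup (generate G S) G"
    using generate_is_subgroup S by (simp add: int_independent_iff)
  have "inj_on ((#>) (generate G S)) (torsion_subgroup G)"
  proof (rule inj_onI)
    fix x y assume "x \<in> torsion_subgroup G" "y \<in> torsion_subgroup G"
      and eq: "generate G S #> x = generate G S #> y"
    then obtain m n :: nat where 1: "x \<in> carrier G" "m > 0" "x [^] m = \<one>" "y \<in> carrier G" "n > 0" "y [^] n = \<one>"
      unfolding torsion_subgroup_def by blast
    have "x [^] (m * n) = \<one>" "y [^] (m * n) = \<one>"
      using 1 by (metis nat_pow_one nat_pow_pow mult.commute)+
    then have "(x \<otimes> inv y) [^] (m * n) = \<one>"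
      using 1 by (simp add: nat_pow_distrib nat_pow_inv)
    moreover have "x \<otimes> inv y \<in> generate G S" using eq 1 rcos_eq_iff[OF F] by blast
    ultimately have "x \<otimes> inv y = \<one>" using independent_torsion_free[OF S, of _ "m * n"] 1 by simp
    then show "x = y" using 1 by (metis inv_closed inv_equality inv_inv)
  qed
  moreover have "(#>) (generate G S) ` torsion_subgroup G \<subseteq> (#>) (generate G S) ` carrier G"
    by (auto simp: torsion_subgroup_def)
  ultimately show ?thesis using fin by (meson finite_imageD finite_subset)
qed

lemma subgroup_torsion_subgroup: "subgroup (torsion_subgroup G) G"
proof (rule subgroupI)
  show "torsion_subgroup G \<noteq> {}" by (auto simp: torsion_subgroup_def intro!: exI[of _ "\<one>"] exI[of _ 1])
next
  fix x y assume "x \<in> torsion_subgroup G" "y \<in> torsion_subgroup G"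
  then obtain m n :: nat where 1: "x \<in> carrier G" "m > 0" "x [^] m = \<one>" "y \<in> carrier G" "n > 0" "y [^] n = \<one>"
    unfolding torsion_subgroup_def by blast
  have "x [^] (m * n) = \<one>" "y [^] (m * n) = \<one>"
    using 1 by (metis nat_pow_one nat_pow_pow mult.commute)+
  then have "(x \<otimes> y) [^] (m * n) = \<one>" using 1 by (simp add: nat_pow_distrib)
  then show "x \<otimes> y \<in> torsion_subgroup G" unfolding torsion_subgroup_def using 1
    by (auto intro!: exI[of _ "m * n"])
qed (auto simp: torsion_subgroup_def nat_pow_inv)

text \<open>This is the kernel-image count for the \<open>n\<close>-th power map on the torsion
  subgroup, taken with the trivial subgroup, whose cosets are singletons. As \<open>n\<close> is
  positive, the whole \<open>n\<close>-torsion of \<open>G\<close> lies in the torsion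
  subgroup.\<close>

lemma card_torsion_subgroup:
  assumes n: "n > 0"
  shows "card (torsion_subgroup G) =
    card ((\<lambda>x. x [^] n) ` torsion_subgroup G) * card {t \<in> carrier G. t [^] (n::nat) = \<one>}"
proof -
  have one: "card ((#>) {\<one>} ` A) = card A" if "A \<subseteq> carrier G" for A
    using that by (intro card_image inj_onI) (auto simp: r_coset_def subset_iff)
  have "(#>) {\<one>} ` torsion_subgroup G \<approx>
      ((#>) ((\<lambda>x. x [^] n) ` {\<one>}) ` (\<lambda>x. x [^] n) ` torsion_subgroup G) \<times> {t \<in> torsion_subgroup G. t [^] n = \<one>}"
    using subgroup_torsion_subgroup subgroup.one_closed
    by (intro cosets_hom_image_eqpoll group_hom_nat_pow triv_subgroup) auto
  then have "card ((#>) {\<one>} ` torsion_subgroup G) =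
      card ((#>) {\<one>} ` (\<lambda>x. x [^] n) ` torsion_subgroup G) * card {t \<in> torsion_subgroup G. t [^] n = \<one>}"
    using bij_betw_same_card unfolding eqpoll_def by (fastforce simp: card_cartesian_product)
  moreover have "{t \<in> torsion_subgroup G. t [^] n = \<one>} = {t \<in> carrier G. t [^] n = \<one>}"
    using n by (auto simp: torsion_subgroup_def)
  ultimately show ?thesis by (subst (asm) (1 2) one) (auto simp: torsion_subgroup_def)
qed


section \<open>Maximal independent sets and the rank\<close>

text \<open>Take a maximal independent set between \<open>S0\<close> and \<open>B\<close>. For
  \<open>x\<close> in \<open>B\<close> outside it, adding \<open>x\<close> creates a relation, and
  that relation expresses a nonzero power of \<open>x\<close> by \<open>S\<close>.\<close>

lemma extend_int_independent:
  assumes B: "finite B" "B \<subseteq> carrier G" and S0: "int_independent G S0" "S0 \<subseteq> B"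
  obtains S where "S0 \<subseteq> S" "S \<subseteq> B" "int_independent G S"
    "\<forall>x\<in>B. \<exists>n::nat>0. x [^] n \<in> generate G S"
proof -
  define A where "A = {S. S0 \<subseteq> S \<and> S \<subseteq> B \<and> int_independent G S}"
  have "finite A" using B(1) unfolding A_def by (rule_tac finite_subset[of _ "Pow B"]) auto
  moreover have "S0 \<in> A" using S0 by (simp add: A_def)
  ultimately obtain S where SA: "S \<in> A" and maxA: "\<And>T. T \<in> A \<Longrightarrow> S \<subseteq> T \<Longrightarrow> S = T"
    by (metis finite_has_maximal2)
  have S: "S0 \<subseteq> S" "S \<subseteq> B" "int_independent G S" using SA by (auto simp: A_def)
  have max: "S = T" if "S \<subseteq> T" "T \<subseteq> B" "int_independent G T" for T
    using maxA that S(1) by (simp add: A_def)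
  have ind: "int_independent G S" "S \<subseteq> carrier G" "finite S"
    using S by (auto simp: int_independent_iff)
  have "\<exists>n::nat>0. x [^] n \<in> generate G S" if x: "x \<in> B" for x
  proof (cases "x \<in> S")
    case True
    then have "x [^] (1::nat) \<in> generate G S" using ind by (simp add: generate.incl subsetD)
    then show ?thesis by (intro exI[of _ 1]) simp
  next
    case False
    have xG: "x \<in> carrier G" using x B by blast
    have "\<not> int_independent G (insert x S)" using max[of "insert x S"] S(2) x False by blast
    then obtain c y where c: "int_comb (insert x S) c = \<one>" "y \<in> insert x S" "c y \<noteq> 0"
      using ind xG by (auto simp: int_independent_iff)
    have split: "x [^] c x \<otimes> int_comb S c = \<one>"
      using c(1) False ind xG unfolding int_comb_def by (subst (asm) finprod_insert) auto
    \<comment> \<open>Otherwise the relation would be a nontrivial one among the elements of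
      \<open>S\<close> alone.\<close>
    have "c x \<noteq> 0"
    proof
      assume "c x = 0"
      then have "int_comb S c = \<one>" using split ind by simp
      then have "\<forall>y\<in>S. c y = 0" using ind(1) unfolding int_independent_iff by blast
      then show False using c \<open>c x = 0\<close> by blast
    qed
    have F: "subgroup (generate G S) G" using generate_is_subgroup ind by blast
    have "x [^] c x = inv (int_comb S c)"
      using split ind xG by (metis inv_equality int_comb_closed int_pow_closed)
    moreover have "int_comb S c \<in> generate G S" using generate_eq_int_combs ind by blast
    ultimately have in_F: "x [^] c x \<in> generate G S" using F by (simp add: subgroup.m_inv_closed)
    \<comment> \<open>The sign turns the integer exponent into a positive natural one.\<close>
    have "x [^] (c x * sgn (c x)) \<in> generate G S"
      using subgroup_int_pow_closed[OF F in_F, of "sgn (c x)"] xG by (simp add: int_pow_pow)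
    moreover have "c x * sgn (c x) = int (nat \<bar>c x\<bar>)" by (simp flip: abs_sgn)
    ultimately have "x [^] nat \<bar>c x\<bar> \<in> generate G S" by (metis int_pow_int)
    then show ?thesis using \<open>c x \<noteq> 0\<close> by (intro exI[of _ "nat \<bar>c x\<bar>"]) simp
  qed
  then show thesis using that S by blast
qed

text \<open>Modulo \<open>F\<close> the coefficient of each generator \<open>x\<close> matters only
  modulo some \<open>N x > 0\<close>, so finitely many coefficient functions represent all
  cosets.\<close>

lemma finite_cosets_of_torsion_generators:
  assumes B: "finite B" "B \<subseteq> carrier G" "generate G B = carrier G" and F: "subgroup F G"
    and tors: "\<And>x. x \<in> B \<Longrightarrow> \<exists>n::nat>0. x [^] n \<in> F"
  shows "finite ((#>) F ` carrier G)"
proof -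
  have "\<forall>x\<in>B. \<exists>n::nat. n > 0 \<and> x [^] n \<in> F" using tors by blast
  from bchoice[OF this] obtain N :: "'a \<Rightarrow> nat" where "\<forall>x\<in>B. N x > 0 \<and> x [^] N x \<in> F"
    by (rule exE)
  then have N: "N x > 0 \<and> x [^] N x \<in> F" if "x \<in> B" for x using that by (rule bspec)
  let ?c = "\<lambda>c. \<lambda>x\<in>B. c x mod int (N x)"
  have "F #> int_comb B c = F #> int_comb B (?c c)" for c
  proof -
    have "int_comb B (\<lambda>x. c x - ?c c x) \<in> F"
      unfolding int_comb_def
    proof (intro finprod_in_subgroup F Pi_I)
      fix x assume x: "x \<in> B"
      have "x [^] (c x - ?c c x) = (x [^] N x) [^] (c x div int (N x))"
        using x B(2) by (simp add: minus_mod_eq_mult_div int_pow_pow subsetD flip: int_pow_int)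
      then show "x [^] (c x - ?c c x) \<in> F" using N[OF x] F by (simp add: subgroup_int_pow_closed)
    qed
    then show ?thesis
      unfolding rcos_eq_iff[OF F int_comb_closed[OF B(2)] int_comb_closed[OF B(2)]]
      by (simp only: int_comb_diff[OF B(2)])
  qed
  moreover have "?c c \<in> PiE B (\<lambda>x. {0..<int (N x)})" for c using N by auto
  ultimately have "(#>) F ` carrier G \<subseteq> (\<lambda>c. F #> int_comb B c) ` PiE B (\<lambda>x. {0..<int (N x)})"
    unfolding B(3)[symmetric] generate_eq_int_combs[OF B(1,2)] by blast
  moreover have "finite (PiE B (\<lambda>x. {0..<int (N x)}))" using B(1) by (intro finite_PiE) auto
  ultimately show ?thesis by (meson finite_imageI finite_subset)
qed

text \<open>By the pigeonhole principle two distinct powers of \<open>x\<close> lie in the same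
  coset of \<open>F\<close>; their quotient is the required power.\<close>

lemma power_in_of_finite_cosets:
  assumes F: "subgroup F G" and C: "subgroup C G" and fin: "finite ((#>) F ` C)" and x: "x \<in> C"
  shows "\<exists>n::nat>0. x [^] n \<in> F"
proof -
  have xG: "x \<in> carrier G" using C x subgroup.mem_carrier by metis
  have "x [^] k \<in> C" for k :: nat
    using subgroup_int_pow_closed[OF C x, of "int k"] by (simp add: int_pow_int)
  then have "range (\<lambda>k::nat. F #> x [^] k) \<subseteq> (#>) F ` C" by blast
  then have "\<not> inj (\<lambda>k::nat. F #> x [^] k)" using fin by (meson finite_imageD finite_subset infinite_UNIV_nat)
  then obtain i j :: nat where ij: "i < j" "F #> x [^] i = F #> x [^] j"
    unfolding inj_def by (metis linorder_neqE_nat)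
  have "F #> x [^] int j = F #> x [^] int i" using ij by (simp add: int_pow_int)
  then have "x [^] (int j - int i) \<in> F" using xG by (simp add: rcos_eq_iff[OF F] int_pow_diff)
  then have "x [^] (j - i) \<in> F" using ij by (simp add: int_pow_int flip: of_nat_diff)
  then show ?thesis using ij by (intro exI[of _ "j - i"]) simp
qed

text \<open>Any independent \<open>T\<close> extends to an independent \<open>T'\<close> whose span
  has finite index as well. The index of the subgroup of squares, computed from \<open>S\<close> and
  from \<open>T'\<close>, gives both the same size. This also bounds the cardinalities, so that
  \<open>Max\<close> is a true maximum.\<close>

lemma rank_group_eq_card:
  assumes B: "finite B" "B \<subseteq> carrier G" "generate G B = carrier G"
    and S: "int_independent G S" and fin: "finite ((#>) (generate G S) ` carrier G)"
  shows "rank_group G = card S"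
proof -
  have le: "card T \<le> card S" if T: "int_independent G T" for T
  proof -
    have TB: "finite (T \<union> B)" "T \<union> B \<subseteq> carrier G" using B T by (auto simp: int_independent_iff)
    obtain T' where T': "T \<subseteq> T'" "T' \<subseteq> T \<union> B" "int_independent G T'"
      "\<forall>x\<in>T \<union> B. \<exists>n::nat>0. x [^] n \<in> generate G T'"
      using extend_int_independent[OF TB T] by blast
    have sub: "subgroup (generate G T') G" using T'(3) generate_is_subgroup by (simp add: int_independent_iff)
    have fin': "finite ((#>) (generate G T') ` carrier G)"
      using finite_cosets_of_torsion_generators[OF B sub] T'(4) by blast
    \<comment> \<open>The 2-torsion is finite and contains the neutral element, so it cancels from
      both index formulas and leaves equal powers of 2.\<close>
    let ?T2 = "{t \<in> carrier G. t [^] (2::nat) = \<one>}"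
    have "finite ?T2" by (rule card_cosets_powers(1)[OF S fin]) simp
    moreover have "\<one> \<in> ?T2" by simp
    ultimately have "card ?T2 \<noteq> 0" by auto
    moreover have "2 ^ card S * card ?T2 = 2 ^ card T' * card ?T2"
      by (rule trans[OF card_cosets_powers(2)[OF S fin, symmetric] card_cosets_powers(2)[OF T'(3) fin']])
        simp_all
    ultimately have "card S = card T'" by auto
    then show ?thesis using T'(1,3) by (auto simp: int_independent_iff intro: card_mono)
  qed
  have "finite {card T |T. int_independent G T}"
    by (rule finite_subset[of _ "{..card S}"]) (use le in auto)
  then show ?thesis unfolding rank_group_def by (intro Max_eqI) (use le S in auto)
qed

section \<open>Passing to subgroups and quotients\<close>

lemma finprod_subgroup_generated:
  assumes "f \<in> A \<rightarrow> carrier (subgroup_generated G T)"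
  shows "finprod (subgroup_generated G T) f A = finprod G f A"
proof -
  interpret K: comm_group "subgroup_generated G T" by (rule abelian_subgroup_generated) (rule comm_group_axioms)
  have "carrier (subgroup_generated G T) \<subseteq> carrier G" by (rule carrier_subgroup_generated_subset)
  then show ?thesis using assms
  proof (induction A rule: infinite_finite_induct)
    case (insert x A)
    then have "f \<in> A \<rightarrow> carrier G" "f x \<in> carrier G"
      "f \<in> A \<rightarrow> carrier (subgroup_generated G T)" "f x \<in> carrier (subgroup_generated G T)"
      by blast+
    then show ?case using insert by simp
  qed auto
qed

lemma subgroup_generated_int_comb:
  assumes S: "S \<subseteq> carrier (subgroup_generated G T)"
  shows "comm_group.int_comb (subgroup_generated G T) S c = int_comb S c"
proof -
  interpret K: comm_group "subgroup_generated G T" by (rule abelian_subgroup_generated) (rule comm_group_axioms)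
  have SG: "S \<subseteq> carrier G" using S carrier_subgroup_generated_subset by blast
  have eq: "x [^]\<^bsub>subgroup_generated G T\<^esub> c x = x [^] c x" if "x \<in> S" for x
    using that S int_pow_subgroup_generated by blast
  have "K.int_comb S c = finprod G (\<lambda>x. x [^]\<^bsub>subgroup_generated G T\<^esub> c x) S"
    unfolding K.int_comb_def by (rule finprod_subgroup_generated) (use S in blast)
  also have "\<dots> = int_comb S c"
    unfolding int_comb_def using eq SG by (intro finprod_cong') auto
  finally show ?thesis .
qed

text \<open>The rank of a sublist is the rank of a subgroup regarded as a group of its own; this
  brings independence there back to \<open>G\<close>.\<close>

lemma subgroup_generated_int_independent:
  assumes S: "S \<subseteq> carrier (subgroup_generated G T)"
  shows "int_independent (subgroup_generated G T) S \<longleftrightarrow> int_independent G S"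
proof -
  interpret K: comm_group "subgroup_generated G T" by (rule abelian_subgroup_generated) (rule comm_group_axioms)
  show ?thesis
    unfolding int_independent_iff K.int_independent_iff
    using S carrier_subgroup_generated_subset subgroup_generated_int_comb[OF S] by auto
qed

lemma generate_subgroup_generated:
  assumes S: "finite S" "S \<subseteq> carrier (subgroup_generated G T)"
  shows "generate (subgroup_generated G T) S = generate G S"
proof -
  interpret K: comm_group "subgroup_generated G T" by (rule abelian_subgroup_generated) (rule comm_group_axioms)
  have "S \<subseteq> carrier G" using S carrier_subgroup_generated_subset by blast
  then show ?thesis
    using subgroup_generated_int_comb[OF S(2)] generate_eq_int_combs K.generate_eq_int_combs S by simp
qed

lemma int_comb_hom:
  assumes f: "group_hom G K f" and K: "comm_group K" and S: "S \<subseteq> carrier G" "inj_on f S"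
  shows "comm_group.int_comb K (f ` S) c = f (int_comb S (\<lambda>x. c (f x)))"
proof -
  interpret f: group_hom G K f by fact
  interpret K: comm_group K by fact
  have "K.int_comb (f ` S) c = finprod K (\<lambda>x. f x [^]\<^bsub>K\<^esub> c (f x)) S"
    unfolding K.int_comb_def using S by (subst K.finprod_reindex) auto
  also have "\<dots> = f (int_comb S (\<lambda>x. c (f x)))"
    using S(1) unfolding int_comb_def
  proof (induction S rule: infinite_finite_induct)
    case (insert x S)
    have "(\<lambda>x. f x [^]\<^bsub>K\<^esub> c (f x)) \<in> S \<rightarrow> carrier K" "(\<lambda>x. x [^] c (f x)) \<in> S \<rightarrow> carrier G"
      using insert by auto
    then show ?case using insert by (simp add: f.hom_int_pow)
  qed auto
  finally show ?thesis .
qed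


text \<open>Additivity of the rank. A maximal independent \<open>S\<close> in \<open>Y\<close> is
  extended to a maximal independent set inside \<open>Y \<union> B\<close>. The added elements
  \<open>U\<close> stay independent modulo the subgroup generated by \<open>Y\<close>, and their
  images span a subgroup of finite index in the quotient.\<close>

lemma exists_independent_in_FactGroup:
  assumes B: "finite B" "B \<subseteq> carrier G" "generate G B = carrier G"
    and Y: "finite Y" "Y \<subseteq> carrier G"
  obtains T where "int_independent (G Mod generate G Y) T"
    "finite ((#>\<^bsub>G Mod generate G Y\<^esub>) (generate (G Mod generate G Y) T) ` carrier (G Mod generate G Y))"
    "rank_group G = rank_group (subgroup_generated G Y) + card T"
proof -
  let ?L = "generate G Y" and ?K = "subgroup_generated G Y"
  let ?Q = "G Mod ?L"
  let ?p = "\<lambda>x. ?L #> x"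
  have L: "subgroup ?L G" using generate_is_subgroup[OF Y(2)] .
  have Ln: "?L \<lhd> G" using L by (rule subgroup_imp_normal)
  interpret Q: comm_group ?Q using L by (rule abelian_FactGroup)
  interpret K: comm_group ?K by (rule abelian_subgroup_generated) (rule comm_group_axioms)
  interpret p: group_hom G ?Q ?p
    using normal.r_coset_hom_Mod[OF Ln] by unfold_locales
  have carK: "carrier ?K = ?L" using Y by (simp add: carrier_subgroup_generated Int_absorb1)
  have ind_empty: "int_independent G {}" by (simp add: int_independent_iff)
  obtain S where "{} \<subseteq> S" and S: "S \<subseteq> Y" "int_independent G S"
    and Stor: "\<forall>x\<in>Y. \<exists>n::nat>0. x [^] n \<in> generate G S"
    by (rule extend_int_independent[OF Y ind_empty empty_subsetI])
  have BY: "finite (Y \<union> B)" "Y \<union> B \<subseteq> carrier G" "S \<subseteq> Y \<union> B" using B Y S by auto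
  obtain T where T: "S \<subseteq> T" "T \<subseteq> Y \<union> B" "int_independent G T"
    and Ttor: "\<forall>x\<in>Y \<union> B. \<exists>n::nat>0. x [^] n \<in> generate G T"
    by (rule extend_int_independent[OF BY(1,2) S(2) BY(3)])
  define U where "U = T - S"
  have fin: "finite S" "S \<subseteq> carrier G" "finite T" "T \<subseteq> carrier G" "finite U" "U \<subseteq> carrier G"
    using S(2) T(3) by (auto simp: int_independent_iff U_def)
  have TU: "T = S \<union> U" "S \<inter> U = {}" using T(1) by (auto simp: U_def)
  have genT: "subgroup (generate G T) G" "subgroup (generate G S) G"
    using fin generate_is_subgroup by blast+
  have YL: "Y \<subseteq> ?L" using generate.incl by fast
  have SL: "S \<subseteq> ?L" using S(1) YL by blast
  have SK: "S \<subseteq> carrier ?K" "Y \<subseteq> carrier ?K" using SL YL carK by auto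
  have rankG: "rank_group G = card T"
    using finite_cosets_of_torsion_generators[OF B genT(1)] Ttor
    by (intro rank_group_eq_card[OF B T(3)]) blast
  have genK: "generate ?K S = generate G S" "generate ?K Y = carrier ?K"
    using generate_subgroup_generated[OF fin(1) SK(1)] generate_subgroup_generated[OF Y(1) SK(2)] carK
    by auto
  have cosetsK: "finite ((#>\<^bsub>?K\<^esub>) (generate ?K S) ` carrier ?K)"
  proof (rule K.finite_cosets_of_torsion_generators[OF Y(1) SK(2) genK(2)])
    show "subgroup (generate ?K S) ?K" using K.generate_is_subgroup[OF SK(1)] .
    show "\<exists>n>0. x [^]\<^bsub>?K\<^esub> (n::nat) \<in> generate ?K S" if "x \<in> Y" for x
      using bspec[OF Stor that] genK by (simp add: pow_subgroup_generated)
  qed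
  have rankL: "rank_group ?K = card S"
    using S(2) cosetsK SK genK(2) Y(1)
    by (intro K.rank_group_eq_card[of Y]) (simp_all add: subgroup_generated_int_independent)
  have finL: "finite ((#>) (generate G S) ` ?L)"
    using cosetsK unfolding genK carK by (simp add: r_coset_def)
  \<comment> \<open>The span of \<open>S\<close> has finite index in \<open>?L\<close>, so some
    power of a combination of \<open>U\<close> lying in \<open>?L\<close> is a combination of
    \<open>S\<close>. This is a relation in \<open>T\<close> with coefficients \<open>e\<close>, and
    independence of \<open>T\<close> makes them vanish.\<close>
  have key: "c x = 0" if c: "int_comb U c \<in> ?L" and x: "x \<in> U" for c x
  proof -
    obtain n :: nat where n: "n > 0" "int_comb U c [^] n \<in> generate G S"
      using power_in_of_finite_cosets[OF genT(2) L finL c] by blast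
    then obtain d where d: "int_comb U c [^] n = int_comb S d"
      by (auto simp: generate_eq_int_combs[OF fin(1,2)])
    define e where "e x = (if x \<in> S then - 1 * d x else int n * c x)" for x
    have "int_comb S e = int_comb S (\<lambda>x. - 1 * d x)"
      using fin by (intro int_comb_cong) (auto simp: e_def)
    also have "\<dots> = inv (int_comb S d)"
      using fin by (subst int_comb_scale) (auto simp: int_pow_neg int_pow_1)
    finally have eS: "int_comb S e = inv (int_comb S d)" .
    have "int_comb U e = int_comb U (\<lambda>x. int n * c x)"
      using fin TU(2) by (intro int_comb_cong) (auto simp: e_def)
    also have "\<dots> = int_comb S d" using fin d by (simp add: int_comb_scale int_pow_int)
    finally have "int_comb T e = \<one>"
      using eS fin TU by (simp add: int_comb_Un)
    then have "e x = 0" using T(3) x TU(1) unfolding int_independent_iff by blast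
    moreover have "x \<notin> S" using x TU(2) by blast
    ultimately show ?thesis using n(1) by (simp add: e_def)
  qed
  have inj: "inj_on ?p U"
  proof (rule inj_onI)
    fix x y assume 1: "x \<in> U" "y \<in> U" "?p x = ?p y"
    \<comment> \<open>If \<open>x\<close> and \<open>y\<close> differed,
      \<open>x \<otimes> inv y\<close> would be a combination in \<open>?L\<close> with coefficient
      1 at \<open>x\<close>, against \<open>key\<close>.\<close>
    have "int_comb U (\<lambda>z. (if z = x then 1 else 0) - (if z = y then 1 else 0)) = x \<otimes> inv y"
      using 1 fin int_comb_single[OF fin(5,6) 1(1), of 1] int_comb_single[OF fin(5,6) 1(2), of 1]
      by (simp add: int_comb_diff int_pow_1 subsetD)
    also have "x \<otimes> inv y \<in> ?L" using 1 fin rcos_eq_iff[OF L] by blast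
    finally have "(if x = x then 1 else 0) - (if x = y then 1 else 0) = (0::int)"
      using key 1(1) by blast
    then show "x = y" by (simp split: if_splits)
  qed
  have ker: "x \<in> ?L" if "x \<in> carrier G" "?p x = \<one>\<^bsub>?Q\<^esub>" for x
    using that coset_join1[OF _ _ L, of x] subgroup.subset[OF L] by simp
  have comb: "Q.int_comb (?p ` U) c = ?p (int_comb U (\<lambda>x. c (?p x)))" for c
    by (rule int_comb_hom[OF p.group_hom_axioms Q.comm_group_axioms fin(6) inj])
  have "int_independent ?Q (?p ` U)"
    unfolding Q.int_independent_iff
  proof (intro conjI allI impI ballI)
    show "?p ` U \<subseteq> carrier ?Q" using fin p.hom_closed by blast
    show "finite (?p ` U)" using fin by blast
    fix c z assume c: "Q.int_comb (?p ` U) c = \<one>\<^bsub>?Q\<^esub>" and "z \<in> ?p ` U"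
    then obtain x where x: "x \<in> U" "z = ?p x" by blast
    have "int_comb U (\<lambda>x. c (?p x)) \<in> ?L"
      using c unfolding comb by (intro ker) (use fin in auto)
    then show "c z = 0" using key[of "\<lambda>x. c (?p x)" x] x by simp
  qed
  \<comment> \<open>A power of each generator is a combination of \<open>T\<close>. Its
    \<open>S\<close>-part dies in the quotient, leaving a combination of the images of
    \<open>U\<close>.\<close>
  moreover have "finite ((#>\<^bsub>?Q\<^esub>) (generate ?Q (?p ` U)) ` carrier ?Q)"
  proof (rule Q.finite_cosets_of_torsion_generators[of "?p ` B"])
    show "finite (?p ` B)" using B by blast
    show "?p ` B \<subseteq> carrier ?Q" using B p.hom_closed by blast
    show "generate ?Q (?p ` B) = carrier ?Q"
      using p.generate_img[OF B(2)] B(3) by (simp add: carrier_FactGroup)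
    show "subgroup (generate ?Q (?p ` U)) ?Q"
      using fin p.hom_closed by (intro Q.generate_is_subgroup) blast
    fix z assume "z \<in> ?p ` B"
    then obtain x where x: "x \<in> B" "z = ?p x" by blast
    then obtain n :: nat where n: "n > 0" "x [^] n \<in> generate G T" using Ttor by blast
    then obtain c where "x [^] n = int_comb T c" by (auto simp: generate_eq_int_combs[OF fin(3,4)])
    then have xn: "x [^] n = int_comb S c \<otimes> int_comb U c" using TU fin by (simp add: int_comb_Un)
    have "int_comb S c \<in> generate G S" using generate_eq_int_combs[OF fin(1,2)] by blast
    also have "generate G S \<subseteq> ?L" using SL by (intro generate_subgroup_incl L)
    finally have "?p (int_comb S c) = \<one>\<^bsub>?Q\<^esub>"
      using coset_join2[OF int_comb_closed L] fin by simp
    then have "?p (x [^] n) = ?p (int_comb U c)" using fin unfolding xn by (simp del: one_FactGroup mult_FactGroup)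
    moreover have "z [^]\<^bsub>?Q\<^esub> n = ?p (x [^] n)" using x B p.hom_nat_pow[of x n] by auto
    moreover have "?p (int_comb U c) \<in> generate ?Q (?p ` U)"
      using p.generate_img[OF fin(6)] generate_eq_int_combs[OF fin(5,6)] by blast
    ultimately show "\<exists>n::nat>0. z [^]\<^bsub>?Q\<^esub> n \<in> generate ?Q (?p ` U)" using n(1) by auto
  qed
  moreover have "rank_group G = rank_group ?K + card (?p ` U)"
    unfolding rankG rankL card_image[OF inj] TU(1) using card_Un_disjoint[OF fin(1,5) TU(2)] .
  ultimately show thesis using that by blast
qed

end

section \<open>Counting homomorphisms\<close>

text \<open>For a finite index set the direct sum is the full product, so a homomorphism into it is
  an arbitrary tuple of homomorphisms into the factors, and it kills \<open>Y\<close> when all of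
  them do.\<close>

lemma (in group) card_homs_sum_group:
  fixes C :: "'i \<Rightarrow> ('c, 'd) monoid_scheme"
  assumes H: "group H" and I: "finite I" and C: "\<And>i. i \<in> I \<Longrightarrow> group (C i)"
    and f: "f \<in> iso H (sum_group I C)" and Y: "Y \<subseteq> carrier G"
  shows "card {\<phi> \<in> hom G H \<inter> extensional (carrier G). \<forall>y\<in>Y. \<phi> y = \<one>\<^bsub>H\<^esub>} =
    (\<Prod>i\<in>I. card {\<psi> \<in> hom G (C i) \<inter> extensional (carrier G). \<forall>y\<in>Y. \<psi> y = \<one>\<^bsub>C i\<^esub>})"
    (is "card ?A = (\<Prod>i\<in>I. card (?B i))")
proof -
  let ?S = "sum_group I C"
  have carS: "carrier ?S = (\<Pi>\<^sub>E i\<in>I. carrier (C i))"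
    using I by (simp add: carrier_sum_group C)
  interpret H: group H by fact
  have S: "group ?S" using C by simp
  interpret f: group_hom H ?S f
    using f S by (simp add: group_hom_def group_hom_axioms_def iso_def H.is_group)
  define h where "h = inv_into (carrier H) f"
  have h: "h \<in> iso ?S H" unfolding h_def using H.iso_set_sym[OF f] .
  interpret h: group_hom ?S H h
    using h S by (simp add: group_hom_def group_hom_axioms_def iso_def H.is_group)
  have bij: "bij_betw f (carrier H) (carrier ?S)" using f by (simp add: iso_def)
  have hf: "h (f x) = x" if "x \<in> carrier H" for x
    using bij that by (simp add: h_def bij_betw_def)
  have fh: "f (h u) = u" if "u \<in> carrier ?S" for u
    using bij that by (simp add: h_def bij_betw_def f_inv_into_f)
  define F where "F \<phi> = (\<lambda>i\<in>I. \<lambda>x\<in>carrier G. f (\<phi> x) i)" for \<phi>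
  have F1: "F \<phi> \<in> PiE I ?B" if \<phi>: "\<phi> \<in> ?A" for \<phi>
  proof -
    have \<phi>c: "\<phi> x \<in> carrier H" if "x \<in> carrier G" for x using \<phi> that by (auto simp: hom_def)
    have "f (\<phi> x) i \<in> carrier (C i)" if "x \<in> carrier G" "i \<in> I" for x i
      using f.hom_closed[OF \<phi>c[OF that(1)]] that(2) unfolding carS by auto
    moreover have "f (\<phi> (x \<otimes> y)) i = f (\<phi> x) i \<otimes>\<^bsub>C i\<^esub> f (\<phi> y) i"
      if "x \<in> carrier G" "y \<in> carrier G" "i \<in> I" for x y i
      using f.hom_mult[OF \<phi>c[OF that(1)] \<phi>c[OF that(2)]] that \<phi> by (simp add: hom_def)
    moreover have "f (\<phi> y) i = \<one>\<^bsub>C i\<^esub>" if "y \<in> Y" "i \<in> I" for y i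
      using that \<phi> f.hom_one by simp
    ultimately show ?thesis using Y unfolding F_def by (auto simp: hom_def)
  qed
  have "bij_betw F ?A (PiE I ?B)"
  proof (rule bij_betwI')
    fix \<phi> \<psi> assume 1: "\<phi> \<in> ?A" "\<psi> \<in> ?A"
    show "(F \<phi> = F \<psi>) = (\<phi> = \<psi>)"
    proof
      assume eq: "F \<phi> = F \<psi>"
      show "\<phi> = \<psi>"
      proof (rule extensionalityI[of _ "carrier G"])
        fix x assume x: "x \<in> carrier G"
        have c: "\<phi> x \<in> carrier H" "\<psi> x \<in> carrier H" using 1 x by (auto simp: hom_def)
        have "f (\<phi> x) i = f (\<psi> x) i" if "i \<in> I" for i
          using fun_cong[OF fun_cong[OF eq, of i], of x] that x by (simp add: F_def)
        then have "f (\<phi> x) = f (\<psi> x)"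
          using f.hom_closed[OF c(1)] f.hom_closed[OF c(2)] unfolding carS by (rule_tac PiE_ext)
        then show "\<phi> x = \<psi> x" using hf c by metis
      qed (use 1 in auto)
    qed simp
  next
    fix \<xi> assume \<xi>: "\<xi> \<in> PiE I ?B"
    define u where "u x = (\<lambda>i\<in>I. \<xi> i x)" for x
    have \<xi>B: "\<xi> i \<in> ?B i" if "i \<in> I" for i using \<xi> that by (rule PiE_mem)
    have "\<xi> i x \<in> carrier (C i)" if "i \<in> I" "x \<in> carrier G" for i x
      using \<xi>B[OF that(1)] that(2) by (auto simp: hom_def)
    then have u: "u x \<in> carrier ?S" if "x \<in> carrier G" for x
      unfolding carS u_def using that by auto
    have um: "u (x \<otimes> y) = u x \<otimes>\<^bsub>?S\<^esub> u y" if "x \<in> carrier G" "y \<in> carrier G" for x y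
      unfolding u_def using \<xi>B that by (auto simp: hom_def intro!: restrict_ext)
    have u1: "u y = \<one>\<^bsub>?S\<^esub>" if "y \<in> Y" for y
      unfolding u_def using \<xi>B that by (auto intro!: restrict_ext)
    \<comment> \<open>The inverse of \<open>F\<close>: the components are glued to
      \<open>u x\<close> and carried back to \<open>H\<close> by the inverse isomorphism
      \<open>h\<close>.\<close>
    define \<phi> where "\<phi> = (\<lambda>x\<in>carrier G. h (u x))"
    have "\<phi> \<in> hom G H"
    proof (rule homI)
      fix x y assume xy: "x \<in> carrier G" "y \<in> carrier G"
      show "\<phi> x \<in> carrier H" using h.hom_closed[OF u[OF xy(1)]] xy by (simp add: \<phi>_def)
      show "\<phi> (x \<otimes> y) = \<phi> x \<otimes>\<^bsub>H\<^esub> \<phi> y"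
        using h.hom_mult[OF u[OF xy(1)] u[OF xy(2)]] um[OF xy] xy by (simp add: \<phi>_def)
    qed
    moreover have "\<phi> y = \<one>\<^bsub>H\<^esub>" if "y \<in> Y" for y
      using u1[OF that] h.hom_one that Y by (auto simp: \<phi>_def)
    ultimately have "\<phi> \<in> ?A" by (simp add: \<phi>_def)
    moreover have "\<xi> = F \<phi>"
    proof (rule PiE_ext[OF \<xi> F1[OF \<open>\<phi> \<in> ?A\<close>]])
      fix i assume i: "i \<in> I"
      show "\<xi> i = F \<phi> i"
      proof (rule extensionalityI[of _ "carrier G"])
        show "\<xi> i \<in> extensional (carrier G)" using \<xi>B[OF i] by simp
        show "F \<phi> i \<in> extensional (carrier G)" using i by (simp add: F_def)
        fix x assume x: "x \<in> carrier G"
        show "\<xi> i x = F \<phi> i x" using i x fh[OF u[OF x]] by (simp add: F_def \<phi>_def u_def)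
      qed
    qed
    ultimately show "\<exists>\<phi>\<in>?A. \<xi> = F \<phi>" by blast
  qed (use F1 in blast)
  then have "card ?A = card (PiE I ?B)" by (rule bij_betw_same_card)
  then show ?thesis using I by (simp add: card_PiE)
qed

context comm_group
begin

text \<open>The homomorphisms number \<open>[Q : nQ]\<close>, which is \<open>n ^ r\<close> times
  the size of the \<open>n\<close>-torsion of the quotient \<open>Q\<close>; multiplying by the size
  of \<open>nT\<close> turns that torsion into the torsion subgroup \<open>T\<close>. The product
  form avoids division of naturals, and one \<open>r\<close> serves all \<open>n\<close>.\<close>

lemma card_homs_mult_card_multiples:
  assumes B: "finite B" "B \<subseteq> carrier G" "generate G B = carrier G"
    and Y: "finite Y" "Y \<subseteq> carrier G"
  obtains r where "rank_group G = rank_group (subgroup_generated G Y) + r"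
    "finite (torsion_subgroup (G Mod generate G Y))"
    "\<forall>n>0. card {\<psi> \<in> hom G (integer_mod_group n) \<inter> extensional (carrier G).
        \<forall>y\<in>Y. \<psi> y = \<one>\<^bsub>integer_mod_group n\<^esub>}
      * card ((\<lambda>h. h [^]\<^bsub>G Mod generate G Y\<^esub> int n) ` torsion_subgroup (G Mod generate G Y))
      = n ^ r * card (torsion_subgroup (G Mod generate G Y))"
proof -
  let ?L = "generate G Y"
  let ?Q = "G Mod ?L"
  let ?p = "\<lambda>x. ?L #> x"
  have L: "subgroup ?L G" using generate_is_subgroup[OF Y(2)] .
  have Ln: "?L \<lhd> G" using L by (rule subgroup_imp_normal)
  interpret Q: comm_group ?Q using L by (rule abelian_FactGroup)
  interpret p: group_hom G ?Q ?p
    using normal.r_coset_hom_Mod[OF Ln] by unfold_locales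
  obtain T where T: "int_independent ?Q T"
    "finite ((#>\<^bsub>?Q\<^esub>) (generate ?Q T) ` carrier ?Q)"
    "rank_group G = rank_group (subgroup_generated G Y) + card T"
    by (rule exists_independent_in_FactGroup[OF B Y])
  have "card {\<psi> \<in> hom G (integer_mod_group n) \<inter> extensional (carrier G).
        \<forall>y\<in>Y. \<psi> y = \<one>\<^bsub>integer_mod_group n\<^esub>}
      * card ((\<lambda>h. h [^]\<^bsub>?Q\<^esub> int n) ` torsion_subgroup ?Q)
      = n ^ card T * card (torsion_subgroup ?Q)" if n: "n > 0" for n
  proof -
    let ?C = "integer_mod_group n"
    let ?P = "(\<lambda>z. z [^]\<^bsub>?Q\<^esub> n) ` carrier ?Q"
    \<comment> \<open>The preimage of \<open>nQ\<close> in \<open>G\<close>. It contains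
      \<open>Y\<close> and all \<open>n\<close>-th powers, so the count of homomorphisms killing
      \<open>N\<close> can be carried out in \<open>G\<close>.\<close>
    define N where "N = {x \<in> carrier G. ?p x \<in> ?P}"
    have P: "subgroup ?P ?Q"
      by (rule group_hom.subgroup_img_is_subgroup[OF Q.group_hom_nat_pow Q.subgroup_self])
    have carQ: "carrier ?Q = ?p ` carrier G" by (simp add: carrier_FactGroup)
    have N: "subgroup N G"
    proof (rule subgroupI)
      have "?p \<one> \<in> ?P" using subgroup.one_closed[OF P] p.hom_one by metis
      then show "N \<noteq> {}" unfolding N_def by blast
      fix x y assume xy: "x \<in> N" "y \<in> N"
      then show "x \<otimes> y \<in> N"
        using p.hom_mult subgroup.m_closed[OF P] by (simp add: N_def del: mult_FactGroup)
    next
      fix x assume x: "x \<in> N"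
      then show "inv x \<in> N"
        using p.hom_inv subgroup.m_inv_closed[OF P] by (simp add: N_def del: mult_FactGroup)
    qed (auto simp: N_def)
    have one_P: "\<one>\<^bsub>?Q\<^esub> \<in> ?P" by (rule subgroup.one_closed[OF P])
    have ker: "kernel G ?Q ?p \<subseteq> N"
      unfolding kernel_def N_def using one_P by auto
    have pN: "?p ` N = ?P"
    proof
      show "?P \<subseteq> ?p ` N"
      proof
        fix z assume z: "z \<in> ?P"
        then have "z \<in> carrier ?Q" using subgroup.subset[OF P] by blast
        then obtain x where "x \<in> carrier G" "z = ?p x" unfolding carQ by blast
        then show "z \<in> ?p ` N" using z unfolding N_def by blast
      qed
    qed (auto simp: N_def)
    have powN: "x [^] n \<in> N" if "x \<in> carrier G" for x
      unfolding N_def using p.hom_nat_pow[OF that, of n] p.hom_closed[OF that] that by auto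
    have YN: "Y \<subseteq> N"
    proof
      fix y assume y: "y \<in> Y"
      then have "?p y = ?L" using coset_join2[OF _ L] Y generate.incl[OF y] by blast
      then show "y \<in> N" using one_P y Y by (auto simp: N_def)
    qed
    have "{\<psi> \<in> hom G ?C \<inter> extensional (carrier G). \<forall>y\<in>Y. \<psi> y = \<one>\<^bsub>?C\<^esub>}
        = homs_killing G (carrier G) ?C N"
    proof (intro equalityI subsetI)
      fix \<psi> assume \<psi>: "\<psi> \<in> {\<psi> \<in> hom G ?C \<inter> extensional (carrier G). \<forall>y\<in>Y. \<psi> y = \<one>\<^bsub>?C\<^esub>}"
      interpret s: group_hom G ?C \<psi>
        using \<psi> by (simp add: group_hom_def group_hom_axioms_def)
      have "?L \<subseteq> kernel G ?C \<psi>"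
        using \<psi> Y by (intro generate_subgroup_incl s.subgroup_kernel) (auto simp: kernel_def)
      then have \<psi>L: "\<psi> x = \<one>\<^bsub>?C\<^esub>" if "x \<in> ?L" for x using that by (auto simp: kernel_def)
      \<comment> \<open>An element of \<open>N\<close> is an \<open>n\<close>-th power times an
        element of \<open>?L\<close>. The former is killed because the target has exponent
        \<open>n\<close>, the latter because \<open>\<psi>\<close> kills \<open>Y\<close>.\<close>
      have "\<psi> x = \<one>\<^bsub>?C\<^esub>" if x: "x \<in> N" for x
      proof -
        have xG: "x \<in> carrier G" using x by (simp add: N_def)
        obtain z where z: "z \<in> carrier ?Q" "?p x = z [^]\<^bsub>?Q\<^esub> n" using x unfolding N_def by blast
        then obtain y where y: "y \<in> carrier G" "z = ?p y" unfolding carQ by blast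
        have "?p x = ?p (y [^] n)" using z y p.hom_nat_pow[OF y(1), of n] by simp
        then have "x \<otimes> inv (y [^] n) \<in> ?L" using rcos_eq_iff[OF L xG] y by simp
        then have "\<psi> (x \<otimes> inv (y [^] n)) = \<one>\<^bsub>?C\<^esub>" by (rule \<psi>L)
        moreover have "x = (x \<otimes> inv (y [^] n)) \<otimes> y [^] n" using xG y by (simp add: m_assoc)
        ultimately have "\<psi> x = \<one>\<^bsub>?C\<^esub> \<otimes>\<^bsub>?C\<^esub> \<psi> (y [^] n)"
          using s.hom_mult[of "x \<otimes> inv (y [^] n)" "y [^] n"] xG y by (metis inv_closed m_closed nat_pow_closed)
        also have "\<psi> (y [^] n) = \<psi> y [^]\<^bsub>?C\<^esub> n" using y by (rule_tac s.hom_nat_pow)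
        finally show ?thesis by simp
      qed
      then show "\<psi> \<in> homs_killing G (carrier G) ?C N" using \<psi> by (simp add: hom_def)
    next
      fix \<psi> assume "\<psi> \<in> homs_killing G (carrier G) ?C N"
      then show "\<psi> \<in> {\<psi> \<in> hom G ?C \<inter> extensional (carrier G). \<forall>y\<in>Y. \<psi> y = \<one>\<^bsub>?C\<^esub>}"
        using YN by (auto simp: hom_def)
    qed
    then have "card {\<psi> \<in> hom G ?C \<inter> extensional (carrier G). \<forall>y\<in>Y. \<psi> y = \<one>\<^bsub>?C\<^esub>}
        = card ((#>) N ` carrier G)"
      using card_homs_killing_integer_mod_group[OF B N n powN] by simp
    also have "\<dots> = card ((#>\<^bsub>?Q\<^esub>) ?P ` carrier ?Q)"
      using card_cosets_hom_image_kernel[OF p.group_hom_axioms N subgroup_self subgroup.subset[OF N] ker]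
      unfolding pN carQ .
    also have "\<dots> = n ^ card T * card {t \<in> carrier ?Q. t [^]\<^bsub>?Q\<^esub> n = \<one>\<^bsub>?Q\<^esub>}"
      by (rule Q.card_cosets_powers(2)[OF T(1,2) n])
    finally show ?thesis using Q.card_torsion_subgroup[OF n] by (simp add: int_pow_int)
  qed
  then show thesis using that[OF T(3) Q.finite_torsion_subgroup[OF T(1,2)]] by blast
qed

end

section \<open>Expansion over subsets and the final formula\<close>

text \<open>Choosing the second summand exactly at the factors in \<open>A\<close> contributes a
  product of indicators, which is 1 if \<open>P\<close> holds throughout \<open>A\<close> and 0
  otherwise.\<close>

lemma prod_one_plus_indicator:
  fixes v :: "'e \<Rightarrow> 'r::comm_ring_1"
  assumes "finite E"
  shows "(\<Prod>e\<in>E. 1 + v e * (if P e then 1 else 0)) =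
    (\<Sum>A\<in>Pow E. if \<forall>e\<in>A. P e then \<Prod>e\<in>A. v e else 0)"
proof -
  have "(\<Prod>e\<in>E. 1 + v e * (if P e then 1 else 0)) = (\<Prod>e\<in>E. v e * (if P e then 1 else 0) + 1)"
    by (simp only: add.commute)
  also have "\<dots> = (\<Sum>A\<in>Pow E. \<Prod>e\<in>A. v e * (if P e then 1 else 0))"
    by (subst prod_add[OF assms]) simp
  also have "\<dots> = (\<Sum>A\<in>Pow E. if \<forall>e\<in>A. P e then \<Prod>e\<in>A. v e else 0)"
  proof (rule sum.cong[OF refl])
    fix A assume "A \<in> Pow E"
    then have "finite A" using assms finite_subset by blast
    then show "(\<Prod>e\<in>A. v e * (if P e then 1 else 0)) = (if \<forall>e\<in>A. P e then \<Prod>e\<in>A. v e else 0)"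
      by (cases "\<forall>e\<in>A. P e") (auto intro!: prod.cong prod_zero)
  qed
  finally show ?thesis .
qed

text \<open>Exchanging the sums over homomorphisms and over subsets leaves, for each
  \<open>A\<close>, one summand per homomorphism vanishing on the sublist.\<close>

lemma Z_poly_expand:
  fixes v :: "'e \<Rightarrow> 'r::comm_ring_1"
  assumes "finite E" and "finite (hom G H \<inter> extensional (carrier G))"
  shows "Z_poly G E g H v = (\<Sum>A\<in>Pow E.
    of_nat (card {\<phi> \<in> hom G H \<inter> extensional (carrier G). \<forall>y\<in>g ` A. \<phi> y = \<one>\<^bsub>H\<^esub>}) * (\<Prod>e\<in>A. v e))"
proof -
  let ?Hom = "hom G H \<inter> extensional (carrier G)"
  have "Z_poly G E g H v = (\<Sum>\<phi>\<in>?Hom. \<Sum>A\<in>Pow E. if \<forall>e\<in>A. \<phi> (g e) = \<one>\<^bsub>H\<^esub> then \<Prod>e\<in>A. v e else 0)"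
    unfolding Z_poly_def by (simp only: prod_one_plus_indicator[OF assms(1)])
  also have "\<dots> = (\<Sum>A\<in>Pow E. \<Sum>\<phi>\<in>?Hom. if \<forall>e\<in>A. \<phi> (g e) = \<one>\<^bsub>H\<^esub> then \<Prod>e\<in>A. v e else 0)"
    by (rule sum.swap)
  also have "\<dots> = (\<Sum>A\<in>Pow E. of_nat (card {\<phi> \<in> ?Hom. \<forall>y\<in>g ` A. \<phi> y = \<one>\<^bsub>H\<^esub>}) * (\<Prod>e\<in>A. v e))"
  proof (rule sum.cong[OF refl])
    fix A
    have "(\<Sum>\<phi>\<in>?Hom. if \<forall>e\<in>A. \<phi> (g e) = \<one>\<^bsub>H\<^esub> then \<Prod>e\<in>A. v e else 0)
        = (\<Sum>\<phi>\<in>{\<phi> \<in> ?Hom. \<forall>e\<in>A. \<phi> (g e) = \<one>\<^bsub>H\<^esub>}. \<Prod>e\<in>A. v e)"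
      by (rule sum.inter_filter[OF assms(2), symmetric])
    then show "(\<Sum>\<phi>\<in>?Hom. if \<forall>e\<in>A. \<phi> (g e) = \<one>\<^bsub>H\<^esub> then \<Prod>e\<in>A. v e else 0)
        = of_nat (card {\<phi> \<in> ?Hom. \<forall>y\<in>g ` A. \<phi> y = \<one>\<^bsub>H\<^esub>}) * (\<Prod>e\<in>A. v e)"
      by simp
  qed
  finally show ?thesis .
qed

theorem theorem7p4:
  fixes G :: "('a, 'm) monoid_scheme"
    and H :: "('b, 'n) monoid_scheme"
    and E :: "'e set" and g :: "'e \<Rightarrow> 'a"
    and k q :: nat and qs :: "nat \<Rightarrow> nat"
    and v :: "'e \<Rightarrow> 'r::field_char_0"
  assumes "comm_group G" and "finitely_generated_group G"
    and "finite E" and "g ` E \<subseteq> carrier G"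
    and "comm_group H" and "finite (carrier H)"
    and "H \<cong> sum_group {1..k} (\<lambda>i. integer_mod_group (qs i))"
    and "q = card (carrier H)"
  shows "Z_poly G E g H v =
    of_nat q ^ rank_group G *
    (\<Sum>A\<in>Pow E. of_nat q powi (- int (rank_list G g A)) *
       (\<Prod>i=1..k. of_nat (mult_list G g A) / of_nat (card (multiples_tors_quot (int (qs i)) G g A))) *
       (\<Prod>e\<in>A. v e))"
proof -
  interpret G: comm_group G by fact
  interpret H: comm_group H by fact
  obtain B where B: "finite B" "B \<subseteq> carrier G" "generate G B = carrier G"
    using assms(2) by (auto simp: finitely_generated_group_def)
  let ?Z = "\<lambda>i. integer_mod_group (qs i)"
  let ?I = "{1..k}"
  let ?S = "sum_group ?I ?Z"
  obtain f where f: "f \<in> iso H ?S" using assms(7) by (auto simp: is_iso_def)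
  then have bij: "bij_betw f (carrier H) (carrier ?S)" by (simp add: iso_def)
  have carS: "carrier ?S = (\<Pi>\<^sub>E i\<in>?I. carrier (?Z i))" by (simp add: carrier_sum_group)
  have finS: "finite (\<Pi>\<^sub>E i\<in>?I. carrier (?Z i))"
    using bij_betw_finite[OF bij] assms(6) carS by simp
  \<comment> \<open>For modulus 0 \<open>integer_mod_group\<close> is the infinite group of
    integers, which finiteness of \<open>H\<close> excludes.\<close>
  have qs: "qs i > 0" if i: "i \<in> ?I" for i
  proof -
    have "(\<Pi>\<^sub>E i\<in>?I. carrier (?Z i)) \<noteq> {}"
      using integer_mod_group_0 by (metis PiE_eq_empty_iff empty_iff)
    then have "finite (carrier (?Z i))" using finS i by (auto simp: finite_PiE_iff)
    then show ?thesis by (auto simp: carrier_integer_mod_group infinite_UNIV_int split: if_splits)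
  qed
  have q: "q = (\<Prod>i\<in>?I. qs i)"
  proof -
    have "q = card (\<Pi>\<^sub>E i\<in>?I. carrier (?Z i))"
      using bij_betw_same_card[OF bij] carS assms(8) by simp
    also have "\<dots> = (\<Prod>i\<in>?I. card (carrier (?Z i)))" by (simp add: card_PiE)
    also have "\<dots> = (\<Prod>i\<in>?I. qs i)"
      using qs by (intro prod.cong refl) (simp add: carrier_integer_mod_group)
    finally show ?thesis .
  qed
  have q0: "q \<noteq> 0" using qs by (auto simp: q)
  let ?h = "\<lambda>Y. {\<phi> \<in> hom G H \<inter> extensional (carrier G). \<forall>y\<in>Y. \<phi> y = \<one>\<^bsub>H\<^esub>}"
  \<comment> \<open>Nonvanishing of the cardinality is recorded along with its value, because it
    certifies below that there are finitely many homomorphisms.\<close>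
  have count: "of_nat (card (?h (g ` A))) =
      (of_nat q ^ rank_group G * (of_nat q powi (- int (rank_list G g A)) *
       (\<Prod>i\<in>?I. of_nat (mult_list G g A) / of_nat (card (multiples_tors_quot (int (qs i)) G g A)))) :: 'r)
      \<and> card (?h (g ` A)) \<noteq> 0"
    if A: "A \<subseteq> E" for A
  proof -
    let ?Y = "g ` A"
    have Y: "finite ?Y" "?Y \<subseteq> carrier G" using A assms(3,4) finite_subset by blast+
    let ?c = "\<lambda>i. card {\<psi> \<in> hom G (?Z i) \<inter> extensional (carrier G). \<forall>y\<in>?Y. \<psi> y = \<one>\<^bsub>?Z i\<^esub>}"
    let ?M = "\<lambda>i. card (multiples_tors_quot (int (qs i)) G g A)"
    let ?m = "mult_list G g A"
    obtain r where r: "rank_group G = rank_list G g A + r"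
      and fin: "finite (tors_quot G g A)"
      and prod: "\<forall>n>0. card {\<psi> \<in> hom G (integer_mod_group n) \<inter> extensional (carrier G).
          \<forall>y\<in>?Y. \<psi> y = \<one>\<^bsub>integer_mod_group n\<^esub>} * card (multiples_tors_quot (int n) G g A) = n ^ r * ?m"
      unfolding rank_list_def tors_quot_def mult_list_def multiples_tors_quot_def
      by (rule G.card_homs_mult_card_multiples[OF B Y])
    have cM: "?c i * ?M i = qs i ^ r * ?m" if "i \<in> ?I" for i
      using prod qs[OF that] by blast
    have Qc: "comm_group (G Mod generate G ?Y)"
      using G.generate_is_subgroup[OF Y(2)] by (rule G.abelian_FactGroup)
    have "tors_quot G g A \<noteq> {}"
      unfolding tors_quot_def
      using subgroup.one_closed[OF comm_group.subgroup_torsion_subgroup[OF Qc]] by blast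
    then have m0: "?m \<noteq> 0" using fin by (simp add: mult_list_def)
    \<comment> \<open>A nonzero product forces both factors to be nonzero; this permits the division
      by \<open>?M i\<close>.\<close>
    have cM0: "?c i * ?M i \<noteq> 0" if "i \<in> ?I" for i
      using cM[OF that] qs[OF that] m0 by (metis mult_eq_0_iff not_gr_zero power_not_zero)
    have c0: "?c i \<noteq> 0" if "i \<in> ?I" for i
      using cM0[OF that] by (simp only: mult_eq_0_iff de_Morgan_disj not_False_eq_True)
    have c: "(of_nat (?c i) :: 'r) = of_nat (qs i) ^ r * (of_nat ?m / of_nat (?M i))" if "i \<in> ?I" for i
    proof -
      have "(of_nat (?c i) :: 'r) * of_nat (?M i) = of_nat (qs i) ^ r * of_nat ?m"
        using arg_cong[OF cM[OF that], of "of_nat :: nat \<Rightarrow> 'r"] by (simp only: of_nat_mult of_nat_power)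
      moreover have "(of_nat (?M i) :: 'r) \<noteq> 0"
        using cM0[OF that] by (simp only: of_nat_eq_0_iff mult_eq_0_iff de_Morgan_disj not_False_eq_True)
      ultimately show ?thesis by (simp only: nonzero_eq_divide_eq times_divide_eq_right not_False_eq_True)
    qed
    have cardh: "card (?h ?Y) = (\<Prod>i\<in>?I. ?c i)"
      by (rule G.card_homs_sum_group[OF H.is_group _ _ f Y(2)]) simp_all
    then have "(of_nat (card (?h ?Y)) :: 'r) = (\<Prod>i\<in>?I. of_nat (?c i))" by (simp only: of_nat_prod)
    also have "\<dots> = (\<Prod>i\<in>?I. of_nat (qs i) ^ r * (of_nat ?m / of_nat (?M i)))"
      using c by (intro prod.cong refl)
    also have "\<dots> = of_nat q ^ r * (\<Prod>i\<in>?I. of_nat ?m / of_nat (?M i))"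
      by (simp only: prod.distrib q of_nat_prod prod_power_distrib)
    \<comment> \<open>The exponent \<open>r\<close> is the difference of the two ranks; splitting
      the power requires \<open>q\<close> to be nonzero.\<close>
    also have "(of_nat q ^ r :: 'r) = of_nat q ^ rank_group G * of_nat q powi (- int (rank_list G g A))"
      using q0 by (simp add: r power_add power_int_minus)
    finally have "(of_nat (card (?h ?Y)) :: 'r) = of_nat q ^ rank_group G * (of_nat q powi (- int (rank_list G g A)) *
       (\<Prod>i\<in>?I. of_nat ?m / of_nat (?M i)))" by (simp only: mult.assoc)
    moreover have "card (?h ?Y) \<noteq> 0" unfolding cardh prod_zero_iff[OF finite_atLeastAtMost] using c0 by blast
    ultimately show ?thesis by blast
  qed
  \<comment> \<open>For empty \<open>A\<close> the vanishing condition is void, so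
    \<open>count\<close> speaks about all homomorphisms; their number is nonzero, hence they form a
    finite set.\<close>
  have "?h (g ` {}) = hom G H \<inter> extensional (carrier G)" by auto
  then have "card (hom G H \<inter> extensional (carrier G)) \<noteq> 0"
    using count[OF empty_subsetI] by metis
  then have "finite (hom G H \<inter> extensional (carrier G))" by (metis card.infinite)
  then have "Z_poly G E g H v = (\<Sum>A\<in>Pow E. of_nat (card (?h (g ` A))) * (\<Prod>e\<in>A. v e))"
    by (rule Z_poly_expand[OF assms(3)])
  also have "\<dots> = (\<Sum>A\<in>Pow E. of_nat q ^ rank_group G * (of_nat q powi (- int (rank_list G g A)) *
       (\<Prod>i\<in>?I. of_nat (mult_list G g A) / of_nat (card (multiples_tors_quot (int (qs i)) G g A))) *
       (\<Prod>e\<in>A. v e)))"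
    using count by (intro sum.cong refl) (simp only: Pow_iff mult.assoc)
  finally show ?thesis by (simp only: sum_distrib_left)
qed

end
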